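(* Let $\mathbf{P}$ be a random field on $\mathbb{Z}^\nu$ with finite state space $\mathcal{X}$. Then $\mathbf{P}$ is a Gibbs random field if and only if it is strictly positive, its one-point finite-conditional distribution $\{q_t^{\tilde x} : t\in\mathbb{Z}^\nu,\ \tilde x\in\widetilde{\mathcal{X}^t}\}$ is uniformly nonnull, and one of the following three conditions holds; moreover these three conditions are equivalent (for strictly positive random fields with uniformly nonnull one-point finite-conditional distribution): (C) for all $t\in\mathbb{Z}^\nu$ and $x\in\mathcal{X}^t$, $$\lim_{\Lambda\uparrow\mathbb{Z}^\nu\setminus t}\ \sup_{\tilde x,\tilde y\in\widetilde{\mathcal{X}^t}:\ \tilde x_\Lambda=\tilde y_\Lambda}\bigl|q_t^{\tilde x}(x)-q_t^{\tilde y}(x)\bigr|=0;$$ (D) for all $t\in\mathbb{Z}^\nu$ and $x\in\mathcal{X}^t$, $$\lim_{\Lambda\uparrow\mathbb{Z}^\nu\setminus t}\ \sup_{J\in\mathcal{E}^*(t^c)}\ \sup_{\tilde x,\tilde y\in\mathcal{X}^J:\ \tilde x_\Lambda=\tilde y_\Lambda}\bigl|q_t^{\tilde x}(x)-q_t^{\tilde y}(x)\bigr|=0;$$ (E) for all $t\in\mathbb{Z}^\nu$ and $x\in\mathcal{X}^t$, $$\lim_{\Lambda\uparrow\mathbb{Z}^\nu\setminus t}\ \sup_{\tilde x\in\widetilde{\mathcal{X}^t}}\bigl|q_t^{\tilde x}(x)-q_t^{\tilde x_\Lambda}(x)\bigr|=0.$$ Here, whenever the notation $\tilde x_\Lambda$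 (or $\tilde y_\Lambda$) appears, only configurations whose support contains $\Lambda$ are considered in the supremum.
   Context: Setting. Fix an integer $\nu\ge 1$ and a finite nonempty set $\mathcal{X}$ with the discrete topology and the $\sigma$-algebra of all subsets. For $S\subset\mathbb{Z}^\nu$: $S^c=\mathbb{Z}^\nu\setminus S$; $\mathcal{E}(S)$ is the set of all finite subsets of $S$ and $\mathcal{E}^*(S)=\mathcal{E}(S)\setminus\{\emptyset\}$; $\mathcal{E}=\mathcal{E}(\mathbb{Z}^\nu)$. One-point sets $\{t\}$ are written $t$. $\mathcal{X}^S$ is the set of configurations on $S$ (product topology and product $\sigma$-algebra); $\mathcal{X}^\emptyset$ consists of the empty configuration only. For $T\subset S$ and $x\in\mathcal{X}^S$, $x_T$ is the restriction of $x$ to $T$; for disjoint $T,S$ and $x\in\mathcal{X}^T$, $y\in\mathcal{X}^S$, $xy\in\mathcal{X}^{T\cup S}$ is the concatenation. For $\Lambda\in\mathcal{E}$, $\widetilde{\mathcal{X}^\Lambda}=\bigcup_{\tilde\Lambda\in\mathcal{E}^*(\Lambda^c)}\mathcal{X}^{\tilde\Lambda}$; the support $\mathfrak{S}(\tilde x)$ of $\tilde x\in\mathcal{X}^{\tilde\Lambda}$ is $\tilde\Lambda$. $\lim_{\Lambda\uparrow S}$ denotes the limit along the net of finite (nonempty) subsets $\Lambda$ of $S$ directed by inclusion. The supremum of nonnegative quantities over an empty set is $0$. A random field is a probability measure $\mathbf{P}$ on $\mathcal{X}^{\mathbb{Z}^\nu}$; $\mathbf{P}_S$ is its marginal on $\mathcal{X}^S$.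 $\mathbf{P}$ is strictly positive if $\mathbf{P}_\Lambda(x)>0$ for all $\Lambda\in\mathcal{E}$, $x\in\mathcal{X}^\Lambda$. The one-point finite-conditional distribution of a strictly positive random field is the system $q_t^{\tilde x}(x)=\mathbf{P}_{t\cup\mathfrak{S}(\tilde x)}(x\tilde x)/\mathbf{P}_{\mathfrak{S}(\tilde x)}(\tilde x)$, $t\in\mathbb{Z}^\nu$, $x\in\mathcal{X}^t$, $\tilde x\in\widetilde{\mathcal{X}^t}$. It is uniformly nonnull if for all $t\in\mathbb{Z}^\nu$ and $x\in\mathcal{X}^t$ one has $\inf_{\tilde x\in\widetilde{\mathcal{X}^t}}q_t^{\tilde x}(x)>0$. Conditional distributions. A system $\mathcal{Q}=\{\mathbf{Q}_\Lambda^{\bar x}: \Lambda\in\mathcal{E},\ \bar x\in\mathcal{X}^{\Lambda^c}\}$, with each $\mathbf{Q}_\Lambda^{\bar x}$ a probability distribution on $\mathcal{X}^\Lambda$, is a version of the conditional distribution of $\mathbf{P}$ if for every $\Lambda\in\mathcal{E}$, for $\mathbf{P}_{\Lambda^c}$-almost all $\bar x$ and all $x\in\mathcal{X}^\Lambda$, $\mathbf{Q}_\Lambda^{\bar x}(x)=\lim_n \mathbf{P}_{\Lambda\cup\Delta_n}(x\bar x_{\Delta_n})/\mathbf{P}_{\Delta_n}(\bar x_{\Delta_n})$, where $(\Delta_n)$ is an increasing sequence of finite sets exhausting $\Lambda^c$ (the limit exists almost surely and is a.s. independent of the sequence; it is the usual conditional probability of $x$ on $\Lambda$ given the configuration on $\Lambda^c$).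 Gibbs random fields. A potential is a function $\Phi:\bigcup_{J\in\mathcal{E}^*(\mathbb{Z}^\nu)}\mathcal{X}^J\to\mathbb{R}\cup\{+\infty\}$. It is uniformly convergent if it is real-valued and for all $t\in\mathbb{Z}^\nu$, $x\in\mathcal{X}^t$ the series $\sum_{\tilde J\in\mathcal{E}(t^c)}\Phi(x\bar x_{\tilde J})$ converges for all $\bar x\in\mathcal{X}^{t^c}$, uniformly in $\bar x$ (unordered sums: for every $\varepsilon>0$ there is a finite family $\mathcal{J}_0\subset\mathcal{E}(t^c)$ such that for every finite family $\mathcal{J}\supset\mathcal{J}_0$ the partial sum over $\mathcal{J}$ differs from the full sum by at most $\varepsilon$ for all $\bar x$). The Gibbsian specification with potential $\Phi$ is $$\mathbf{Q}_\Lambda^{\bar x}(x)=\frac{\exp(-U_\Lambda^{\bar x}(x))}{\sum_{y\in\mathcal{X}^\Lambda}\exp(-U_\Lambda^{\bar x}(y))},\qquad U_\Lambda^{\bar x}(x)=\sum_{\emptyset\ne J\subset\Lambda}\ \sum_{\tilde J\in\mathcal{E}(\Lambda^c)}\Phi(x_J\bar x_{\tilde J}),$$ for $\Lambda\in\mathcal{E}$, $x\in\mathcal{X}^\Lambda$, $\bar x\in\mathcal{X}^{\Lambda^c}$. A Gibbs random field is a random field that has, for some uniformly convergent potential $\Phi$, the Gibbsian specification with potential $\Phi$ as a version of its conditional distribution. *)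

theory Defs
  imports "HOL-Probability.Probability"
begin

type_synonym 'n site = "(int, 'n) vec"
type_synonym ('n, 'x) config = "'n site \<Rightarrow> 'x"

(* Configurations on S are the extensional functions on S, so that configs S is the space of the
   product measurable space over S; concatenation is the library's merge. *)
definition configs :: "'n::finite site set \<Rightarrow> ('n, 'x::finite) config set" where
  "configs S = (S \<rightarrow>\<^sub>E UNIV)"

definition config_space :: "'n::finite site set \<Rightarrow> ('n, 'x::finite) config measure" where
  "config_space S = (\<Pi>\<^sub>M t\<in>S. count_space UNIV)"

(* An extensional function does not determine its support (its default value is itself a state),
   so the configurations with finite nonempty support disjoint from L are pairs whose first
   component is the support. *)
type_synonym ('n, 'x) supp_config = "'n site set \<times> ('n, 'x) config"

definition outer_configs :: "'n::finite site set \<Rightarrow> ('n, 'x::finite) supp_config set" where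
  "outer_configs L = (SIGMA J:Fpow (- L) - {{}}. configs J)"

definition supp_restrict ::
    "('n::finite, 'x::finite) supp_config \<Rightarrow> 'n site set \<Rightarrow> ('n, 'x) supp_config" where
  "supp_restrict z L = (L, restrict (snd z) L)"


definition random_field :: "('n::finite, 'x::finite) config measure \<Rightarrow> bool" where
  "random_field P \<longleftrightarrow> prob_space P \<and> sets P = sets (config_space UNIV)"

definition marginal ::
    "('n::finite, 'x::finite) config measure \<Rightarrow> 'n site set \<Rightarrow> ('n, 'x) config measure" where
  "marginal P S = distr P (config_space S) (\<lambda>\<omega>. restrict \<omega> S)"

definition marginal_prob ::
    "('n::finite, 'x::finite) config measure \<Rightarrow> 'n site set \<Rightarrow> ('n, 'x) config \<Rightarrow> real" where
  "marginal_prob P L x = measure (marginal P L) {x}"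

definition strictly_positive :: "('n::finite, 'x::finite) config measure \<Rightarrow> bool" where
  "strictly_positive P \<longleftrightarrow> (\<forall>L. finite L \<longrightarrow> (\<forall>x\<in>configs L. marginal_prob P L x > 0))"

definition one_point_cond ::
    "('n::finite, 'x::finite) config measure \<Rightarrow> 'n site \<Rightarrow> ('n, 'x) supp_config
      \<Rightarrow> ('n, 'x) config \<Rightarrow> real" where
  "one_point_cond P t z x =
     marginal_prob P ({t} \<union> fst z) (merge {t} (fst z) (x, snd z)) / marginal_prob P (fst z) (snd z)"

definition uniformly_nonnull :: "('n::finite, 'x::finite) config measure \<Rightarrow> bool" where
  "uniformly_nonnull P \<longleftrightarrow>
     (\<forall>t. \<forall>x\<in>configs {t}. (INF z\<in>outer_configs {t}. one_point_cond P t z x) > 0)"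


(* The almost sure limit does not depend on the exhausting sequence; the exceptional null set
   may. *)
definition cond_distribution_version ::
    "('n::finite, 'x::finite) config measure
      \<Rightarrow> ('n site set \<Rightarrow> ('n, 'x) config \<Rightarrow> ('n, 'x) config \<Rightarrow> real) \<Rightarrow> bool" where
  "cond_distribution_version P Q \<longleftrightarrow>
     (\<forall>L. finite L \<longrightarrow>
        (\<forall>b\<in>configs (- L). (\<forall>x\<in>configs L. Q L b x \<ge> 0) \<and> (\<Sum>x\<in>configs L. Q L b x) = 1) \<and>
        (\<forall>D :: nat \<Rightarrow> 'n site set.
           incseq D \<longrightarrow> (\<forall>n. finite (D n)) \<longrightarrow> (\<Union>n. D n) = - L \<longrightarrow>
           (AE b in marginal P (- L). \<forall>x\<in>configs L.
              (\<lambda>n. marginal_prob P (L \<union> D n) (merge L (D n) (x, restrict b (D n)))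
                     / marginal_prob P (D n) (restrict b (D n)))
              \<longlonglongrightarrow> Q L b x)))"


(* A potential is applied to a finite nonempty set J and a configuration on J. Uniform convergence
   includes being real-valued, so the value plus infinity is left out of the type. *)
type_synonym ('n, 'x) potential = "'n site set \<Rightarrow> ('n, 'x) config \<Rightarrow> real"

definition uniformly_convergent_potential :: "('n::finite, 'x::finite) potential \<Rightarrow> bool" where
  "uniformly_convergent_potential \<Phi> \<longleftrightarrow>
     (\<forall>t. \<forall>x\<in>configs {t}.
        let term = (\<lambda>b J. \<Phi> ({t} \<union> J) (merge {t} J (x, restrict b J))) in
        (\<forall>b\<in>configs (- {t}). term b summable_on Fpow (- {t})) \<and>
        uniform_limit (configs (- {t}))
          (\<lambda>\<J> b. \<Sum>J\<in>\<J>. term b J)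
          (\<lambda>b. \<Sum>\<^sub>\<infinity>J\<in>Fpow (- {t}). term b J)
          (finite_subsets_at_top (Fpow (- {t}))))"

definition gibbs_energy ::
    "('n::finite, 'x::finite) potential \<Rightarrow> 'n site set \<Rightarrow> ('n, 'x) config \<Rightarrow> ('n, 'x) config
      \<Rightarrow> real" where
  "gibbs_energy \<Phi> L b x =
     (\<Sum>J\<in>Pow L - {{}}. \<Sum>\<^sub>\<infinity>K\<in>Fpow (- L).
        \<Phi> (J \<union> K) (merge J K (restrict x J, restrict b K)))"

definition gibbs_specification ::
    "('n::finite, 'x::finite) potential \<Rightarrow> 'n site set \<Rightarrow> ('n, 'x) config \<Rightarrow> ('n, 'x) config
      \<Rightarrow> real" where
  "gibbs_specification \<Phi> L b x =
     exp (- gibbs_energy \<Phi> L b x) / (\<Sum>y\<in>configs L. exp (- gibbs_energy \<Phi> L b y))"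

definition gibbs_random_field :: "('n::finite, 'x::finite) config measure \<Rightarrow> bool" where
  "gibbs_random_field P \<longleftrightarrow> random_field P \<and>
     (\<exists>\<Phi>. uniformly_convergent_potential \<Phi> \<and>
          cond_distribution_version P (gibbs_specification \<Phi>))"


(* Suprema are taken in ennreal, where the supremum of the empty set is 0. *)
definition cond_C :: "('n::finite, 'x::finite) config measure \<Rightarrow> bool" where
  "cond_C P \<longleftrightarrow>
     (\<forall>t. \<forall>x\<in>configs {t}.
        ((\<lambda>L. SUP (y, z) \<in> {(y, z). y \<in> outer_configs {t} \<and> z \<in> outer_configs {t} \<and>
                  L \<subseteq> fst y \<and> L \<subseteq> fst z \<and> supp_restrict y L = supp_restrict z L}.
              ennreal \<bar>one_point_cond P t y x - one_point_cond P t z x\<bar>)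
          \<longlongrightarrow> 0) (finite_subsets_at_top (- {t})))"

definition cond_D :: "('n::finite, 'x::finite) config measure \<Rightarrow> bool" where
  "cond_D P \<longleftrightarrow>
     (\<forall>t. \<forall>x\<in>configs {t}.
        ((\<lambda>L. SUP J \<in> Fpow (- {t}) - {{}}.
              SUP (y, z) \<in> {(y, z). y \<in> configs J \<and> z \<in> configs J \<and>
                  L \<subseteq> J \<and> restrict y L = restrict z L}.
              ennreal \<bar>one_point_cond P t (J, y) x - one_point_cond P t (J, z) x\<bar>)
          \<longlongrightarrow> 0) (finite_subsets_at_top (- {t})))"

definition cond_E :: "('n::finite, 'x::finite) config measure \<Rightarrow> bool" where
  "cond_E P \<longleftrightarrow>
     (\<forall>t. \<forall>x\<in>configs {t}.
        ((\<lambda>L. SUP z \<in> {z \<in> outer_configs {t}. L \<subseteq> fst z}.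
              ennreal \<bar>one_point_cond P t z x - one_point_cond P t (supp_restrict z L) x\<bar>)
          \<longlongrightarrow> 0) (finite_subsets_at_top (- {t})))"

end

(* If P is Gibbsian for a potential Phi, its one-site conditional probabilities given the whole
   exterior are quasilocal and bounded below, and each q_t^z is an average of them over the exterior
   configurations extending z; this gives positivity, nonnullness and (C). Clearly (C) implies (D);
   averaging gives (E) from (D), and the triangle inequality gives (C) from (E).

   Conversely, enumerate the sites as e_0, e_1, ... and turn a configuration into a fixed vacuum one
   site at a time. The logarithmic cost g_n of erasing e_n once e_0, ..., e_(n-1) are erased depends
   only on the sites e_n, e_(n+1), ..., and by (C) and nonnullness it is the uniform limit of its
   versions in finite windows. Telescoping each g_n along fast growing blocks {e_n, ..., e_k} gives
   a potential supported on blocks. It is absolutely summable at every site, since a site e_j lies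
   only in blocks with n <= j, and by the chain rule its energy differences are the sums of the g_n. *)

theory Submission
  imports Defs
begin

text \<open>The obstacle is that (C) carries no rate of convergence. The classical vacuum potential,
  obtained by inclusion-exclusion over all subsets, is an alternating sum of exponentially many
  terms, and uniform continuity alone does not control its unordered series. Telescoping does: along
  a sparse chain of windows the increments of one g_n after the first are at most 1, 1/2, 1/4, ...,
  whatever the modulus of continuity, and the chain is chosen separately for each n. Because of the
  fixed order of erasure the norms of the g_n may grow freely with n. The price is a potential tied
  to the enumeration, without lattice symmetry. Nonnullness keeps the arguments of the logarithm
  away from 0, so that closeness of probabilities passes to logarithms. In the other direction the
  specification is linked to P only almost surely and through limits. Its estimates are therefore
  integrated over cylinders and kept as products rather than quotients, so that positivity of P can
  be a consequence of them.\<close>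

section \<open>Cylinder probabilities\<close>

text \<open>Cylinders are described by total configurations, of which only the values on the window
  count; this avoids restrictions and merges.\<close>
definition cyl_prob :: "('n::finite, 'x::finite) config measure \<Rightarrow> 'n site set \<Rightarrow> ('n, 'x) config \<Rightarrow> real"
  where "cyl_prob P W z = measure P {w. \<forall>i\<in>W. w i = z i}"

text \<open>The one-point conditional probability with a state \<open>a\<close> in place of a
  configuration on \<open>{t}\<close>. The update overwrites \<open>z t\<close>, so for
  \<open>t\<close> outside \<open>J\<close> the value of \<open>z\<close> at \<open>t\<close> has no
  influence.\<close>

definition site_cond ::
    "('n::finite, 'x::finite) config measure \<Rightarrow> 'n site \<Rightarrow> 'x \<Rightarrow> 'n site set \<Rightarrow> ('n, 'x) config \<Rightarrow> real"
  where "site_cond P t a J z = cyl_prob P (insert t J) (z(t := a)) / cyl_prob P J z"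

lemma cyl_prob_cong:
  assumes "\<And>i. i \<in> W \<Longrightarrow> z i = z' i"
  shows "cyl_prob P W z = cyl_prob P W z'"
  using assms unfolding cyl_prob_def by (intro arg_cong[where f = "measure P"]) auto

lemma site_cond_cong:
  assumes "\<And>i. i \<in> J \<Longrightarrow> z i = z' i"
  shows "site_cond P t a J z = site_cond P t a J z'"
  unfolding site_cond_def using assms by (auto intro!: arg_cong2[where f = "(/)"] cyl_prob_cong)

lemma finite_configs: "finite L \<Longrightarrow> finite (configs L :: ('n::finite, 'x::finite) config set)"
  unfolding configs_def by (intro finite_PiE) auto

lemma restrict_in_configs [simp]: "restrict z S \<in> configs S"
  by (auto simp: configs_def)

lemma site_config:
  assumes "x \<in> configs {t}"
  shows "x = restrict (\<lambda>_. x t) {t}"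
  using assms by (auto simp: configs_def PiE_def extensional_def restrict_def fun_eq_iff)

lemma configs_singleton_iff:
  "(\<forall>x\<in>configs {t}. Q x) \<longleftrightarrow> (\<forall>a. Q (restrict (\<lambda>_. a) {t}))"
  by (metis restrict_in_configs site_config)

lemma restrict_eq_iff: "restrict z L = restrict z' L \<longleftrightarrow> (\<forall>i\<in>L. z i = z' i)"
  by (metis restrict_apply restrict_ext)

lemma configs_restrict: "y \<in> configs W \<Longrightarrow> restrict y W = y"
  by (simp add: configs_def PiE_restrict)

section \<open>Functions of finitely many coordinates\<close>

definition local_on :: "'n::finite site set \<Rightarrow> (('n, 'x::finite) config \<Rightarrow> 'b) \<Rightarrow> bool"
  where "local_on L f \<longleftrightarrow> (\<forall>z z'. (\<forall>i\<in>L. z i = z' i) \<longrightarrow> f z = f z')"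

lemma local_onI:
  assumes "\<And>z z'. (\<And>i. i \<in> L \<Longrightarrow> z i = z' i) \<Longrightarrow> f z = f z'"
  shows "local_on L f"
  using assms unfolding local_on_def by blast

lemma local_onD: "local_on L f \<Longrightarrow> (\<And>i. i \<in> L \<Longrightarrow> z i = z' i) \<Longrightarrow> f z = f z'"
  unfolding local_on_def by blast

lemma local_on_restrict: "local_on L f \<Longrightarrow> f (restrict z L) = f z"
  by (auto intro: local_onD)

lemma local_on_combine:
  assumes "local_on D f" "local_on D g"
  shows "local_on D (\<lambda>w. F (f w) (g w))"
  by (intro local_onI arg_cong2[where f = F] local_onD[OF assms(1)] local_onD[OF assms(2)])

text \<open>Every value is already taken on the finite set \<open>configs L\<close>. This elementary
  fact does the work of compactness of the configuration space: it yields upper bounds and strictly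
  positive lower bounds.\<close>

lemma local_finite_range:
  fixes f :: "('n::finite, 'x::finite) config \<Rightarrow> 'b"
  assumes "finite L" "local_on L f"
  shows "finite (range f)"
proof (rule finite_subset)
  show "range f \<subseteq> f ` configs L"
  proof safe
    fix z
    show "f z \<in> f ` configs L"
      using local_on_restrict[OF assms(2), of z] by (metis image_eqI restrict_in_configs)
  qed
qed (use finite_configs assms in auto)

lemma local_pos_lower_bound:
  fixes f :: "('n::finite, 'x::finite) config \<Rightarrow> real"
  assumes "finite L" "local_on L f" and pos: "\<And>z. f z > 0"
  shows "\<exists>c>0. \<forall>z. c \<le> f z"
  using local_finite_range[OF assms(1,2)] pos
  by (intro exI[of _ "Min (range f)"]) auto

lemma local_bounded:
  fixes f :: "('n::finite, 'x::finite) config \<Rightarrow> real"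
  assumes "finite L" "local_on L f"
  shows "\<exists>B. \<forall>z. \<bar>f z\<bar> \<le> B"
proof -
  have "finite (range (\<lambda>z. \<bar>f z\<bar>))"
    using local_finite_range[OF assms] by (metis finite_imageI image_image)
  then show ?thesis
    by (intro exI[of _ "Max (range (\<lambda>z. \<bar>f z\<bar>))"]) (auto intro: Max_ge)
qed

section \<open>Cylinder events and integrals of local functions\<close>

context
  fixes P :: "('n::finite, 'x::finite) config measure"
  assumes field: "random_field P"
begin

interpretation prob_space P
  using field by (simp add: random_field_def)

lemma space_field: "space P = UNIV"
proof -
  have "space P = space (config_space UNIV)"
    using field by (intro sets_eq_imp_space_eq) (simp add: random_field_def)
  then show ?thesis by (simp add: config_space_def space_PiM)
qed

lemma measurable_restrict_field: "(\<lambda>w. restrict w S) \<in> measurable P (config_space S)"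
proof -
  have "(\<lambda>w. restrict w S) \<in> measurable (config_space UNIV) (config_space S)"
    unfolding config_space_def by (rule measurable_restrict_subset) auto
  then show ?thesis
    using field measurable_cong_sets[of P "config_space UNIV" "config_space S" "config_space S"]
    unfolding random_field_def by blast
qed

lemma singleton_sets_config_space:
  assumes "finite W" "y \<in> configs W"
  shows "{y} \<in> sets (config_space W)"
proof -
  have "{y} = PiE W (\<lambda>i. {y i})"
    using assms by (auto simp: configs_def intro: PiE_ext)
  then show ?thesis
    unfolding config_space_def using assms by (auto intro!: sets_PiM_I_finite)
qed

lemma cylinder_sets:
  assumes "finite W"
  shows "{w. \<forall>i\<in>W. w i = z i} \<in> sets P"
proof -
  have "(\<lambda>w. restrict w W) -` {restrict z W} \<inter> space P \<in> sets P"
    using assms by (intro measurable_sets[OF measurable_restrict_field] singleton_sets_config_space) auto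
  moreover have "(\<lambda>w. restrict w W) -` {restrict z W} \<inter> space P = {w. \<forall>i\<in>W. w i = z i}"
    by (auto simp: space_field restrict_eq_iff)
  ultimately show ?thesis by simp
qed

lemma marginal_prob_eq:
  assumes "finite W" "y \<in> configs W"
  shows "marginal_prob P W y = cyl_prob P W y"
proof -
  have "(\<lambda>w. restrict w W) -` {y} \<inter> space P = {w. \<forall>i\<in>W. w i = y i}"
    using configs_restrict[OF assms(2)] restrict_eq_iff[of _ W y] by (auto simp: space_field)
  then show ?thesis
    unfolding marginal_prob_def marginal_def cyl_prob_def
    by (simp add: measure_distr measurable_restrict_field singleton_sets_config_space assms)
qed

lemma measure_partition:
  assumes "finite D" "A \<in> sets P"
  shows "measure P A = (\<Sum>y\<in>configs D. measure P (A \<inter> {w. \<forall>i\<in>D. w i = y i}))"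
proof -
  have "A = (\<Union>y\<in>configs D. A \<inter> {w. \<forall>i\<in>D. w i = y i})"
  proof safe
    fix w assume "w \<in> A"
    then show "w \<in> (\<Union>y\<in>configs D. A \<inter> {w. \<forall>i\<in>D. w i = y i})"
      by (intro UN_I[of "restrict w D"]) auto
  qed
  moreover have "disjoint_family_on (\<lambda>y. A \<inter> {w. \<forall>i\<in>D. w i = y i}) (configs D)"
  proof (unfold disjoint_family_on_def, safe)
    fix y y' w
    assume *: "y \<in> configs D" "y' \<in> configs D" "y \<noteq> y'"
      "\<forall>i\<in>D. w i = y i" "\<forall>i\<in>D. w i = y' i"
    have "y = y'"
      using * by (intro PiE_ext[of y D "\<lambda>_. UNIV"]) (auto simp: configs_def)
    then show "w \<in> {}" using * by simp
  qed
  ultimately show ?thesis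
    using finite_measure_finite_Union[of "configs D" "\<lambda>y. A \<inter> {w. \<forall>i\<in>D. w i = y i}"]
      assms cylinder_sets[OF assms(1)] finite_configs[OF assms(1)]
    by auto
qed

lemma cyl_prob_sum:
  assumes "finite V" "finite W" "V \<inter> W = {}"
  shows "cyl_prob P W z = (\<Sum>y\<in>configs V. cyl_prob P (V \<union> W) (override_on z y V))"
proof -
  have "{w. \<forall>i\<in>W. w i = z i} \<inter> {w. \<forall>i\<in>V. w i = y i}
      = {w. \<forall>i\<in>V \<union> W. w i = override_on z y V i}" for y
    using assms(3) by (auto simp: override_on_def)
  then show ?thesis
    unfolding cyl_prob_def
    using measure_partition[OF assms(1) cylinder_sets[OF assms(2)]] by simp
qed

lemma cyl_prob_nonneg: "cyl_prob P W z \<ge> 0"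
  by (simp add: cyl_prob_def)

lemma cyl_prob_mono:
  assumes "finite W" "W \<subseteq> V"
  shows "cyl_prob P V z \<le> cyl_prob P W z"
  unfolding cyl_prob_def using assms
  by (intro finite_measure_mono cylinder_sets) auto

lemma cyl_prob_empty: "cyl_prob P {} z = 1"
  using prob_space by (simp add: cyl_prob_def space_field)

text \<open>Only the summand of \<open>restrict w D\<close> survives. As a finite combination of
  cylinder indicators, a local function gets its measurability and its integral from those of
  cylinders.\<close>

lemma local_expansion:
  fixes F :: "('n, 'x) config \<Rightarrow> real"
  assumes "finite D" "local_on D F"
  shows "F w = (\<Sum>y\<in>configs D. F y * indicator {w. \<forall>i\<in>D. w i = y i} w)"
proof -
  have "(\<Sum>y\<in>configs D. F y * indicator {w. \<forall>i\<in>D. w i = y i} w)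
      = (\<Sum>y\<in>{restrict w D}. F y * indicator {w. \<forall>i\<in>D. w i = y i} w)"
    using finite_configs[OF assms(1)]
    by (intro sum.mono_neutral_right)
      (auto simp: indicator_def configs_def intro!: PiE_ext)
  also have "\<dots> = F w" using local_on_restrict[OF assms(2)] by simp
  finally show ?thesis by simp
qed

lemma local_measurable:
  fixes F :: "('n, 'x) config \<Rightarrow> real"
  assumes "finite D" "local_on D F"
  shows "F \<in> borel_measurable P"
proof -
  have "(\<lambda>w. \<Sum>y\<in>configs D. F y * indicator {w. \<forall>i\<in>D. w i = y i} w) \<in> borel_measurable P"
    using cylinder_sets[OF assms(1)] by (intro borel_measurable_sum borel_measurable_times) auto
  then show ?thesis using measurable_cong[of P F, OF local_expansion[OF assms]] by blast
qed

lemma local_integral: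
  fixes F :: "('n, 'x) config \<Rightarrow> real"
  assumes "finite D" "local_on D F"
  shows "integral\<^sup>L P F = (\<Sum>y\<in>configs D. F y * cyl_prob P D y)"
proof -
  have "integral\<^sup>L P F = (\<integral>w. (\<Sum>y\<in>configs D. F y * indicator {w. \<forall>i\<in>D. w i = y i} w) \<partial>P)"
    by (rule Bochner_Integration.integral_cong[OF refl local_expansion[OF assms]])
  also have "\<dots> = (\<Sum>y\<in>configs D. (\<integral>w. F y * indicator {w. \<forall>i\<in>D. w i = y i} w \<partial>P))"
    using cylinder_sets[OF assms(1)]
    by (subst Bochner_Integration.integral_sum) (auto simp: emeasure_eq_measure)
  also have "\<dots> = (\<Sum>y\<in>configs D. F y * cyl_prob P D y)"
    by (simp add: cyl_prob_def space_field)
  finally show ?thesis .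
qed

lemma strictly_positive_iff:
  "strictly_positive P \<longleftrightarrow> (\<forall>W z. finite W \<longrightarrow> cyl_prob P W z > 0)"
proof -
  have "cyl_prob P W z = cyl_prob P W (restrict z W)" for W z
    by (rule cyl_prob_cong) auto
  then show ?thesis
    unfolding strictly_positive_def by (metis marginal_prob_eq restrict_in_configs)
qed

lemma one_point_cond_eq:
  assumes "x \<in> configs {t}" "finite J" "t \<notin> J" "z \<in> configs J"
  shows "one_point_cond P t (J, z) x = site_cond P t (x t) J z"
proof -
  have "merge {t} J (x, z) \<in> configs ({t} \<union> J)"
    by (auto simp: configs_def merge_def PiE_iff extensional_def)
  then have "marginal_prob P ({t} \<union> J) (merge {t} J (x, z)) = cyl_prob P ({t} \<union> J) (merge {t} J (x, z))"
    using assms by (intro marginal_prob_eq) auto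
  also have "\<dots> = cyl_prob P (insert t J) (z(t := x t))"
    using assms(3) by (auto intro!: cyl_prob_cong simp: merge_def)
  finally show ?thesis
    using assms by (simp add: one_point_cond_def site_cond_def marginal_prob_eq)
qed

end

section \<open>The conditions in terms of total configurations\<close>

lemma infinite_sites: "infinite (UNIV :: 'n::finite site set)"
proof
  assume "finite (UNIV :: 'n site set)"
  moreover have "inj (\<lambda>k::int. (\<chi> i. k) :: 'n site)"
    by (auto simp: inj_def vec_eq_iff)
  ultimately show False
    using finite_imageD[of "\<lambda>k::int. (\<chi> i. k) :: 'n site" UNIV] finite_subset[OF subset_UNIV]
      infinite_UNIV_int by blast
qed

text \<open>The supports in \<open>outer_configs\<close> are nonempty. A support that contains a
  nonempty window is nonempty by itself, so along the net this side condition disappears.\<close>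

lemma eventually_nonempty_window: "\<forall>\<^sub>F L in finite_subsets_at_top (- {t :: 'n::finite site}). L \<noteq> {}"
proof -
  have "infinite (- {t})" using infinite_sites[where 'n = 'n] by (simp add: finite_compl)
  then obtain s where "s \<in> - {t}" by (metis finite.emptyI equals0I)
  then show ?thesis
    unfolding eventually_finite_subsets_at_top by (intro exI[of _ "{s}"]) auto
qed

text \<open>A supremum in \<open>ennreal\<close> always exists and is 0 over the empty set, so the
  limit is an epsilon statement with neither boundedness nor nonemptiness to check.\<close>

lemma ennreal_SUP_tendsto_0_iff:
  fixes f :: "'a \<Rightarrow> 'b \<Rightarrow> real"
  shows "((\<lambda>L. SUP i\<in>I L. ennreal \<bar>f L i\<bar>) \<longlongrightarrow> 0) F
    \<longleftrightarrow> (\<forall>\<epsilon>>0. \<forall>\<^sub>F L in F. \<forall>i\<in>I L. \<bar>f L i\<bar> \<le> \<epsilon>)"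
    (is "(?g \<longlongrightarrow> 0) F \<longleftrightarrow> ?R")
proof
  assume lim: "(?g \<longlongrightarrow> 0) F"
  show ?R
  proof safe
    fix \<epsilon> :: real assume "\<epsilon> > 0"
    then have "\<forall>\<^sub>F L in F. ?g L < ennreal \<epsilon>"
      by (intro order_tendstoD(2)[OF lim]) simp
    then show "\<forall>\<^sub>F L in F. \<forall>i\<in>I L. \<bar>f L i\<bar> \<le> \<epsilon>"
    proof eventually_elim
      case (elim L)
      show ?case
      proof
        fix i assume "i \<in> I L"
        then have "ennreal \<bar>f L i\<bar> \<le> ?g L" by (rule SUP_upper)
        then show "\<bar>f L i\<bar> \<le> \<epsilon>" using elim \<open>\<epsilon> > 0\<close>
          by (metis ennreal_le_iff le_less order.trans)
      qed
    qed
  qed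
next
  assume R: ?R
  show "(?g \<longlongrightarrow> 0) F"
  proof (rule order_tendstoI)
    fix u :: ennreal assume "0 < u"
    \<comment> \<open>\<open>u\<close> may be infinite; a value strictly between 0 and
      \<open>u\<close> is a positive real in any case.\<close>
    then obtain \<epsilon> where \<epsilon>: "0 < \<epsilon>" "\<epsilon> < u" using dense by blast
    then obtain r where r: "\<epsilon> = ennreal r" "r > 0"
      by (cases \<epsilon>) (auto simp: ennreal_less_zero_iff top_unique)
    have "\<forall>\<^sub>F L in F. \<forall>i\<in>I L. \<bar>f L i\<bar> \<le> r" using R r by blast
    then show "\<forall>\<^sub>F L in F. ?g L < u"
    proof eventually_elim
      case (elim L)
      have "?g L \<le> \<epsilon>" using elim r by (intro SUP_least) (auto intro!: ennreal_leI)
      then show ?case using \<epsilon>(2) by (rule le_less_trans)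
    qed
  qed simp
qed

definition window_C :: "('n::finite, 'x::finite) config measure \<Rightarrow> bool" where
  "window_C P \<longleftrightarrow> (\<forall>t a. \<forall>\<epsilon>>0. \<forall>\<^sub>F L in finite_subsets_at_top (- {t}).
     \<forall>J J' z z'. finite J \<and> finite J' \<and> t \<notin> J \<and> t \<notin> J' \<and> L \<subseteq> J \<and> L \<subseteq> J' \<and> (\<forall>i\<in>L. z i = z' i)
       \<longrightarrow> \<bar>site_cond P t a J z - site_cond P t a J' z'\<bar> \<le> \<epsilon>)"

definition window_D :: "('n::finite, 'x::finite) config measure \<Rightarrow> bool" where
  "window_D P \<longleftrightarrow> (\<forall>t a. \<forall>\<epsilon>>0. \<forall>\<^sub>F L in finite_subsets_at_top (- {t}).
     \<forall>J z z'. finite J \<and> t \<notin> J \<and> L \<subseteq> J \<and> (\<forall>i\<in>L. z i = z' i)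
       \<longrightarrow> \<bar>site_cond P t a J z - site_cond P t a J z'\<bar> \<le> \<epsilon>)"

definition window_E :: "('n::finite, 'x::finite) config measure \<Rightarrow> bool" where
  "window_E P \<longleftrightarrow> (\<forall>t a. \<forall>\<epsilon>>0. \<forall>\<^sub>F L in finite_subsets_at_top (- {t}).
     \<forall>J z. finite J \<and> t \<notin> J \<and> L \<subseteq> J
       \<longrightarrow> \<bar>site_cond P t a J z - site_cond P t a L z\<bar> \<le> \<epsilon>)"

lemma outer_configs_iff:
  "(J, z) \<in> outer_configs {t} \<longleftrightarrow> finite J \<and> t \<notin> J \<and> J \<noteq> {} \<and> z \<in> configs J"
  by (auto simp: outer_configs_def Fpow_def)

lemma eventually_window_cong:
  assumes "\<And>L. finite L \<Longrightarrow> L \<noteq> {} \<Longrightarrow> t \<notin> L \<Longrightarrow> A L \<longleftrightarrow> B L"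
  shows "eventually A (finite_subsets_at_top (- {t :: 'n::finite site})) \<longleftrightarrow> eventually B (finite_subsets_at_top (- {t}))"
proof (rule eventually_cong)
  have "\<forall>\<^sub>F L in finite_subsets_at_top (- {t}). finite L \<and> L \<subseteq> - {t}" by auto
  then show "\<forall>\<^sub>F L in finite_subsets_at_top (- {t}). finite L \<and> L \<subseteq> - {t} \<and> L \<noteq> {}"
    using eventually_nonempty_window[of t] by eventually_elim auto
qed (use assms in auto)

section \<open>Translation of (C), (D), (E) and their equivalence\<close>

context
  fixes P :: "('n::finite, 'x::finite) config measure"
  assumes field: "random_field P"
begin

lemma cond_C_iff: "cond_C P \<longleftrightarrow> window_C P"
proof -
  have *: "(\<forall>i\<in>{(y, z). y \<in> outer_configs {t} \<and> z \<in> outer_configs {t} \<and> L \<subseteq> fst y \<and> L \<subseteq> fst z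
            \<and> supp_restrict y L = supp_restrict z L}.
         \<bar>case i of (y, z) \<Rightarrow> one_point_cond P t y (restrict (\<lambda>_. a) {t}) - one_point_cond P t z (restrict (\<lambda>_. a) {t})\<bar> \<le> \<epsilon>)
      \<longleftrightarrow> (\<forall>J J' z z'. finite J \<and> finite J' \<and> t \<notin> J \<and> t \<notin> J' \<and> L \<subseteq> J \<and> L \<subseteq> J' \<and> (\<forall>i\<in>L. z i = z' i)
       \<longrightarrow> \<bar>site_cond P t a J z - site_cond P t a J' z'\<bar> \<le> \<epsilon>)" (is "?l \<longleftrightarrow> ?r")
    if "L \<noteq> {}" for t a \<epsilon> L
  proof
    assume l: ?l
    show ?r
    proof safe
      fix J J' and z z' :: "('n, 'x) config"
      assume h: "finite J" "finite J'" "t \<notin> J" "t \<notin> J'" "L \<subseteq> J" "L \<subseteq> J'" "\<forall>i\<in>L. z i = z' i"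
      have "supp_restrict (J, restrict z J) L = supp_restrict (J', restrict z' J') L"
        using h by (auto simp: supp_restrict_def restrict_eq_iff simp del: restrict_restrict)
      then have "\<bar>one_point_cond P t (J, restrict z J) (restrict (\<lambda>_. a) {t})
          - one_point_cond P t (J', restrict z' J') (restrict (\<lambda>_. a) {t})\<bar> \<le> \<epsilon>"
        using h that by (intro bspec[OF l, of "((J, restrict z J), (J', restrict z' J'))", simplified])
          (auto simp: outer_configs_iff)
      moreover have "site_cond P t a J z = site_cond P t a J (restrict z J)"
        "site_cond P t a J' z' = site_cond P t a J' (restrict z' J')"
        by (auto intro: site_cond_cong)
      ultimately show "\<bar>site_cond P t a J z - site_cond P t a J' z'\<bar> \<le> \<epsilon>"
        using h by (simp add: one_point_cond_eq[OF field])
    qed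
  next
    assume r: ?r
    show ?l
    proof (clarsimp simp: outer_configs_iff one_point_cond_eq[OF field])
      fix J J' and z z' :: "('n, 'x) config"
      assume "supp_restrict (J, z) L = supp_restrict (J', z') L" "L \<subseteq> J" "L \<subseteq> J'"
        "finite J" "t \<notin> J" "finite J'" "t \<notin> J'"
      moreover from this(1) have "\<forall>i\<in>L. z i = z' i"
        by (simp add: supp_restrict_def restrict_eq_iff)
      ultimately show "\<bar>site_cond P t a J z - site_cond P t a J' z'\<bar> \<le> \<epsilon>"
        by (intro r[rule_format]) auto
    qed
  qed
  show ?thesis
    unfolding cond_C_def window_C_def configs_singleton_iff
    unfolding case_prod_unfold ennreal_SUP_tendsto_0_iff
    by (intro all_cong1 imp_cong refl eventually_window_cong *[unfolded case_prod_unfold])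
qed

lemma cond_D_iff: "cond_D P \<longleftrightarrow> window_D P"
proof -
  \<comment> \<open>Flattening the nested supremum makes (D) an instance of the same criterion as
    (C) and (E).\<close>
  have Sigma: "(SUP J\<in>A. SUP (y, z)\<in>B J. ennreal \<bar>f J y z\<bar>)
      = (SUP p\<in>(SIGMA J:A. B J). ennreal \<bar>f (fst p) (fst (snd p)) (snd (snd p))\<bar>)" (is "?l = ?r")
    for A :: "'n site set set" and B and f :: "'n site set \<Rightarrow> ('n, 'x) config \<Rightarrow> ('n, 'x) config \<Rightarrow> real"
  proof (rule antisym)
    show "?l \<le> ?r"
      by (rule SUP_least)+ (auto intro!: SUP_upper2)
    show "?r \<le> ?l"
      by (rule SUP_least) (auto intro!: SUP_upper2)
  qed
  have *: "(\<forall>i\<in>(SIGMA J:Fpow (- {t}) - {{}}. {(y, z). y \<in> configs J \<and> z \<in> configs J \<and> L \<subseteq> J \<and> restrict y L = restrict z L}).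
         \<bar>one_point_cond P t (fst i, fst (snd i)) (restrict (\<lambda>_. a) {t}) - one_point_cond P t (fst i, snd (snd i)) (restrict (\<lambda>_. a) {t})\<bar> \<le> \<epsilon>)
      \<longleftrightarrow> (\<forall>J z z'. finite J \<and> t \<notin> J \<and> L \<subseteq> J \<and> (\<forall>i\<in>L. z i = z' i)
       \<longrightarrow> \<bar>site_cond P t a J z - site_cond P t a J z'\<bar> \<le> \<epsilon>)" (is "?l \<longleftrightarrow> ?r")
    if "L \<noteq> {}" for t a \<epsilon> L
  proof
    assume l: ?l
    show ?r
    proof safe
      fix J and z z' :: "('n, 'x) config"
      assume h: "finite J" "t \<notin> J" "L \<subseteq> J" "\<forall>i\<in>L. z i = z' i"
      have "restrict (restrict z J) L = restrict (restrict z' J) L"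
        using h by (auto simp: restrict_eq_iff)
      then have "\<bar>one_point_cond P t (J, restrict z J) (restrict (\<lambda>_. a) {t})
          - one_point_cond P t (J, restrict z' J) (restrict (\<lambda>_. a) {t})\<bar> \<le> \<epsilon>"
        using h that by (intro bspec[OF l, of "(J, restrict z J, restrict z' J)", simplified])
          (auto simp: Fpow_def)
      moreover have "site_cond P t a J z = site_cond P t a J (restrict z J)"
        "site_cond P t a J z' = site_cond P t a J (restrict z' J)"
        by (auto intro: site_cond_cong)
      ultimately show "\<bar>site_cond P t a J z - site_cond P t a J z'\<bar> \<le> \<epsilon>"
        using h by (simp add: one_point_cond_eq[OF field])
    qed
  next
    assume r: ?r
    show ?l
    proof (clarsimp simp: Fpow_def)
      fix J and z z' :: "('n, 'x) config"
      assume h: "restrict z L = restrict z' L" "L \<subseteq> J" "finite J" "t \<notin> J"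
        "z \<in> configs J" "z' \<in> configs J"
      from h(1) have "\<forall>i\<in>L. z i = z' i"
        by (simp add: restrict_eq_iff)
      then have "\<bar>site_cond P t a J z - site_cond P t a J z'\<bar> \<le> \<epsilon>" using r h by blast
      then show "\<bar>one_point_cond P t (J, z) (restrict (\<lambda>_. a) {t})
          - one_point_cond P t (J, z') (restrict (\<lambda>_. a) {t})\<bar> \<le> \<epsilon>"
        using h by (simp add: one_point_cond_eq[OF field])
    qed
  qed
  show ?thesis
    unfolding cond_D_def window_D_def configs_singleton_iff Sigma ennreal_SUP_tendsto_0_iff
    by (intro all_cong1 imp_cong refl eventually_window_cong *)
qed

lemma cond_E_iff: "cond_E P \<longleftrightarrow> window_E P"
proof -
  have *: "(\<forall>z\<in>{z \<in> outer_configs {t}. L \<subseteq> fst z}.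
         \<bar>one_point_cond P t z (restrict (\<lambda>_. a) {t}) - one_point_cond P t (supp_restrict z L) (restrict (\<lambda>_. a) {t})\<bar> \<le> \<epsilon>)
      \<longleftrightarrow> (\<forall>J z. finite J \<and> t \<notin> J \<and> L \<subseteq> J
       \<longrightarrow> \<bar>site_cond P t a J z - site_cond P t a L z\<bar> \<le> \<epsilon>)" (is "?l \<longleftrightarrow> ?r")
    if L: "L \<noteq> {}" "finite L" "t \<notin> L" for t a \<epsilon> L
  proof -
    have supp: "one_point_cond P t (supp_restrict (J, z) L) (restrict (\<lambda>_. a) {t}) = site_cond P t a L z"
      for J z
    proof -
      have "site_cond P t a L (restrict z L) = site_cond P t a L z" by (rule site_cond_cong) auto
      then show ?thesis using L by (simp add: supp_restrict_def one_point_cond_eq[OF field])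
    qed
    show ?thesis
    proof
      assume l: ?l
      show ?r
      proof safe
        fix J and z :: "('n, 'x) config"
        assume h: "finite J" "t \<notin> J" "L \<subseteq> J"
        have "site_cond P t a J z = site_cond P t a J (restrict z J)"
          "site_cond P t a L (restrict z J) = site_cond P t a L z"
          using h by (auto intro!: site_cond_cong)
        moreover have "(J, restrict z J) \<in> {z \<in> outer_configs {t}. L \<subseteq> fst z}"
          using h L by (auto simp: outer_configs_iff)
        from bspec[OF l this] have "\<bar>site_cond P t a J (restrict z J) - site_cond P t a L (restrict z J)\<bar> \<le> \<epsilon>"
          using h by (simp add: one_point_cond_eq[OF field] supp)
        ultimately show "\<bar>site_cond P t a J z - site_cond P t a L z\<bar> \<le> \<epsilon>" by simp
      qed
    next
      assume ?r
      then show ?l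
        by (auto simp: outer_configs_iff one_point_cond_eq[OF field] supp)
    qed
  qed
  show ?thesis
    unfolding cond_E_def window_E_def configs_singleton_iff ennreal_SUP_tendsto_0_iff
    by (intro all_cong1 imp_cong refl eventually_window_cong) (rule *)
qed

text \<open>The conditional probability on \<open>L\<close> is the average of those on
  \<open>J\<close> over all refillings \<open>?z y\<close> of \<open>J - L\<close>, with weights
  proportional to \<open>cyl_prob P J (?z y)\<close>. Each refilling agrees with \<open>z\<close> on
  \<open>L\<close>, so (D) puts every averaged term within \<open>\<epsilon>\<close> of the value at
  \<open>z\<close>, and hence the average too.\<close>

lemma window_D_imp_E:
  assumes pos: "\<And>W z. finite W \<Longrightarrow> cyl_prob P W z > 0" and "window_D P"
  shows "window_E P"
  unfolding window_E_def
proof (intro allI impI)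
  fix t a and \<epsilon> :: real assume "\<epsilon> > 0"
  then have "\<forall>\<^sub>F L in finite_subsets_at_top (- {t}). finite L \<and>
     (\<forall>J z z'. finite J \<and> t \<notin> J \<and> L \<subseteq> J \<and> (\<forall>i\<in>L. z i = z' i)
       \<longrightarrow> \<bar>site_cond P t a J z - site_cond P t a J z'\<bar> \<le> \<epsilon>)"
    using assms(2) by (auto simp: window_D_def eventually_conj_iff)
  then show "\<forall>\<^sub>F L in finite_subsets_at_top (- {t}). \<forall>J z. finite J \<and> t \<notin> J \<and> L \<subseteq> J
       \<longrightarrow> \<bar>site_cond P t a J z - site_cond P t a L z\<bar> \<le> \<epsilon>"
  proof eventually_elim
    case (elim L)
    show ?case
    proof safe
      fix J and z :: "('n, 'x) config" assume J: "finite J" "t \<notin> J" "L \<subseteq> J"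
      let ?z = "\<lambda>y. override_on z y (J - L)"
      let ?c = "site_cond P t a J z"
      have "finite L" "t \<notin> L" using elim J by auto
      have sL: "cyl_prob P L z = (\<Sum>y\<in>configs (J - L). cyl_prob P J (?z y))"
        using cyl_prob_sum[OF field, of "J - L" L z] J \<open>finite L\<close> by (auto simp: Un_absorb2)
      have "cyl_prob P (insert t L) (z(t := a))
          = (\<Sum>y\<in>configs (J - L). cyl_prob P (insert t J) (override_on (z(t := a)) y (J - L)))"
        using cyl_prob_sum[OF field, of "J - L" "insert t L" "z(t := a)"] J \<open>finite L\<close>
        by (auto simp: Un_absorb2)
      also have "\<dots> = (\<Sum>y\<in>configs (J - L). site_cond P t a J (?z y) * cyl_prob P J (?z y))"
      proof (intro sum.cong refl)
        fix y
        have "override_on (z(t := a)) y (J - L) = (?z y)(t := a)"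
          using J by (auto simp: override_on_def)
        then show "cyl_prob P (insert t J) (override_on (z(t := a)) y (J - L))
            = site_cond P t a J (?z y) * cyl_prob P J (?z y)"
          using pos[OF J(1), of "?z y"] by (simp add: site_cond_def)
      qed
      finally have "\<bar>cyl_prob P (insert t L) (z(t := a)) - ?c * cyl_prob P L z\<bar>
          = \<bar>\<Sum>y\<in>configs (J - L). (site_cond P t a J (?z y) - ?c) * cyl_prob P J (?z y)\<bar>"
        by (simp add: sL sum_distrib_left sum_subtractf left_diff_distrib)
      also have "\<dots> \<le> (\<Sum>y\<in>configs (J - L). \<epsilon> * cyl_prob P J (?z y))"
      proof (rule order_trans[OF sum_abs], rule sum_mono)
        fix y
        have "\<bar>site_cond P t a J (?z y) - ?c\<bar> \<le> \<epsilon>"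
          using elim J by (intro elim[THEN conjunct2, rule_format]) (auto simp: override_on_def)
        then show "\<bar>(site_cond P t a J (?z y) - ?c) * cyl_prob P J (?z y)\<bar> \<le> \<epsilon> * cyl_prob P J (?z y)"
          using pos[OF J(1), of "?z y"] by (simp add: abs_mult)
      qed
      also have "\<dots> = \<epsilon> * cyl_prob P L z" by (simp add: sL sum_distrib_left)
      finally have "\<bar>cyl_prob P (insert t L) (z(t := a)) / cyl_prob P L z - ?c\<bar> \<le> \<epsilon>"
        using pos[OF \<open>finite L\<close>, of z] by (simp add: abs_le_iff field_simps)
      then show "\<bar>?c - site_cond P t a L z\<bar> \<le> \<epsilon>"
        by (simp add: site_cond_def[of P t a L z] abs_minus_commute)
    qed
  qed
qed

lemma window_E_imp_C:
  assumes "window_E P"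
  shows "window_C P"
  unfolding window_C_def
proof (intro allI impI)
  fix t a and \<epsilon> :: real assume "\<epsilon> > 0"
  then have "\<forall>\<^sub>F L in finite_subsets_at_top (- {t}). \<forall>J z. finite J \<and> t \<notin> J \<and> L \<subseteq> J
       \<longrightarrow> \<bar>site_cond P t a J z - site_cond P t a L z\<bar> \<le> \<epsilon> / 2"
    using assms half_gt_zero unfolding window_E_def by blast
  then show "\<forall>\<^sub>F L in finite_subsets_at_top (- {t}).
     \<forall>J J' z z'. finite J \<and> finite J' \<and> t \<notin> J \<and> t \<notin> J' \<and> L \<subseteq> J \<and> L \<subseteq> J' \<and> (\<forall>i\<in>L. z i = z' i)
       \<longrightarrow> \<bar>site_cond P t a J z - site_cond P t a J' z'\<bar> \<le> \<epsilon>"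
  proof eventually_elim
    case (elim L)
    show ?case
    proof safe
      fix J J' and z z' :: "('n, 'x) config"
      assume h: "finite J" "finite J'" "t \<notin> J" "t \<notin> J'" "L \<subseteq> J" "L \<subseteq> J'" "\<forall>i\<in>L. z i = z' i"
      have "\<bar>site_cond P t a J z - site_cond P t a L z\<bar> \<le> \<epsilon> / 2"
        "\<bar>site_cond P t a J' z' - site_cond P t a L z'\<bar> \<le> \<epsilon> / 2"
        using elim h by blast+
      moreover have "site_cond P t a L z = site_cond P t a L z'"
        using h by (intro site_cond_cong) auto
      ultimately show "\<bar>site_cond P t a J z - site_cond P t a J' z'\<bar> \<le> \<epsilon>" by linarith
    qed
  qed
qed

lemma window_C_imp_D: "window_C P \<Longrightarrow> window_D P"
  unfolding window_C_def window_D_def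
  by (intro allI impI) (elim allE impE, assumption, erule eventually_mono, blast)

lemma cond_C_D_E_equiv:
  assumes "strictly_positive P"
  shows "cond_C P \<longleftrightarrow> cond_D P" "cond_D P \<longleftrightarrow> cond_E P"
  using window_C_imp_D window_D_imp_E window_E_imp_C assms
  unfolding cond_C_iff cond_D_iff cond_E_iff strictly_positive_iff[OF field] by blast+

end

section \<open>Gibbs random fields satisfy the conditions\<close>

text \<open>Only \<open>J = {t}\<close> contributes, so the one-site energy is precisely the series
  in the definition of uniform convergence.\<close>

lemma gibbs_energy_site:
  assumes "x \<in> configs {t}"
  shows "gibbs_energy \<Phi> {t} b x =
    (\<Sum>\<^sub>\<infinity>K\<in>Fpow (- {t}). \<Phi> ({t} \<union> K) (merge {t} K (x, restrict b K)))"
proof -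
  have "Pow {t} - {{}} = {{t}}" by auto
  then show ?thesis using configs_restrict[OF assms] by (simp add: gibbs_energy_def)
qed

text \<open>A finite partial sum within \<open>\<epsilon> / 2\<close> of the energy, uniformly in
  the exterior, sees only the union of its index sets; that union is the window.\<close>

lemma energy_oscillation_site:
  fixes \<Phi> :: "('n::finite, 'x::finite) potential"
  assumes "uniformly_convergent_potential \<Phi>" "x \<in> configs {t}" "\<epsilon> > 0"
  shows "\<exists>L. finite L \<and> L \<subseteq> - {t} \<and> (\<forall>b\<in>configs (- {t}). \<forall>b'\<in>configs (- {t}).
    (\<forall>i\<in>L. b i = b' i) \<longrightarrow> \<bar>gibbs_energy \<Phi> {t} b x - gibbs_energy \<Phi> {t} b' x\<bar> \<le> \<epsilon>)"
proof -
  define u where "u = (\<lambda>b J. \<Phi> ({t} \<union> J) (merge {t} J (x, restrict b J)))"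
  have "uniform_limit (configs (- {t})) (\<lambda>\<J> b. \<Sum>J\<in>\<J>. u b J)
          (\<lambda>b. gibbs_energy \<Phi> {t} b x) (finite_subsets_at_top (Fpow (- {t})))"
    using assms by (simp add: uniformly_convergent_potential_def Let_def u_def gibbs_energy_site)
  from uniform_limitD[OF this, of "\<epsilon> / 2"] assms(3)
  have "\<forall>\<^sub>F \<J> in finite_subsets_at_top (Fpow (- {t})). \<forall>b\<in>configs (- {t}).
      dist (\<Sum>J\<in>\<J>. u b J) (gibbs_energy \<Phi> {t} b x) < \<epsilon> / 2" by simp
  then obtain \<J> where J: "finite \<J>" "\<J> \<subseteq> Fpow (- {t})"
    and close: "\<And>b. b \<in> configs (- {t}) \<Longrightarrow> \<bar>(\<Sum>J\<in>\<J>. u b J) - gibbs_energy \<Phi> {t} b x\<bar> < \<epsilon> / 2"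
    unfolding eventually_finite_subsets_at_top dist_real_def by (metis (no_types, lifting) subset_refl)
  show ?thesis
  proof (intro exI conjI ballI impI)
    show "finite (\<Union>\<J>)" "\<Union>\<J> \<subseteq> - {t}" using J by (auto simp: Fpow_def)
    fix b b' :: "('n, 'x) config"
    assume b: "b \<in> configs (- {t})" "b' \<in> configs (- {t})" "\<forall>i\<in>\<Union>\<J>. b i = b' i"
    have "restrict b K = restrict b' K" if "K \<in> \<J>" for K
      unfolding restrict_eq_iff using that b by blast
    then have "(\<Sum>K\<in>\<J>. u b K) = (\<Sum>K\<in>\<J>. u b' K)"
      unfolding u_def by (intro sum.cong refl) simp
    then show "\<bar>gibbs_energy \<Phi> {t} b x - gibbs_energy \<Phi> {t} b' x\<bar> \<le> \<epsilon>"
      using close[OF b(1)] close[OF b(2)] by linarith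
  qed
qed

text \<open>The window has to serve all states at \<open>t\<close> simultaneously because the
  partition function involves all of them; the union over the finitely many states does.\<close>

lemma energy_oscillation:
  fixes \<Phi> :: "('n::finite, 'x::finite) potential"
  assumes "uniformly_convergent_potential \<Phi>" "\<epsilon> > 0"
  shows "\<exists>L. finite L \<and> L \<subseteq> - {t} \<and> (\<forall>x\<in>configs {t}. \<forall>b\<in>configs (- {t}). \<forall>b'\<in>configs (- {t}).
    (\<forall>i\<in>L. b i = b' i) \<longrightarrow> \<bar>gibbs_energy \<Phi> {t} b x - gibbs_energy \<Phi> {t} b' x\<bar> \<le> \<epsilon>)"
proof -
  have "\<forall>x\<in>configs {t}. \<exists>L. finite L \<and> L \<subseteq> - {t} \<and> (\<forall>b\<in>configs (- {t}). \<forall>b'\<in>configs (- {t}).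
    (\<forall>i\<in>L. b i = b' i) \<longrightarrow> \<bar>gibbs_energy \<Phi> {t} b x - gibbs_energy \<Phi> {t} b' x\<bar> \<le> \<epsilon>)"
    using energy_oscillation_site[OF assms(1) _ assms(2)] by blast
  then obtain L where L: "\<And>x. x \<in> configs {t} \<Longrightarrow> finite (L x) \<and> L x \<subseteq> - {t} \<and>
    (\<forall>b\<in>configs (- {t}). \<forall>b'\<in>configs (- {t}).
    (\<forall>i\<in>L x. b i = b' i) \<longrightarrow> \<bar>gibbs_energy \<Phi> {t} b x - gibbs_energy \<Phi> {t} b' x\<bar> \<le> \<epsilon>)"
    by metis
  show ?thesis
  proof (intro exI conjI ballI impI)
    show "finite (\<Union>x\<in>configs {t}. L x)" "(\<Union>x\<in>configs {t}. L x) \<subseteq> - {t}"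
      using L finite_configs[of "{t}", where 'x = 'x] by auto
    fix x b b' :: "('n, 'x) config"
    assume "x \<in> configs {t}" "b \<in> configs (- {t})" "b' \<in> configs (- {t})"
      "\<forall>i\<in>\<Union>x\<in>configs {t}. L x. b i = b' i"
    then show "\<bar>gibbs_energy \<Phi> {t} b x - gibbs_energy \<Phi> {t} b' x\<bar> \<le> \<epsilon>"
      using L[of x] by auto
  qed
qed

lemma partition_function_pos:
  assumes "finite L"
  shows "(\<Sum>y\<in>configs L. exp (- gibbs_energy \<Phi> L b y)) > 0"
  using finite_configs[OF assms] by (intro sum_pos) (auto simp: configs_def PiE_eq_empty_iff)

lemma gibbs_specification_pos:
  assumes "finite L"
  shows "gibbs_specification \<Phi> L b x > 0"
  unfolding gibbs_specification_def by (intro divide_pos_pos partition_function_pos assms) simp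

lemma gibbs_specification_sum:
  assumes "finite L"
  shows "(\<Sum>x\<in>configs L. gibbs_specification \<Phi> L b x) = 1"
  using partition_function_pos[OF assms, of \<Phi> b]
  by (simp add: gibbs_specification_def flip: sum_divide_distrib)

lemma gibbs_specification_le_1:
  assumes "finite L" "x \<in> configs L"
  shows "gibbs_specification \<Phi> L b x \<le> 1"
  unfolding gibbs_specification_sum[OF assms(1), of \<Phi> b, symmetric]
  using assms finite_configs[OF assms(1)]
  by (intro member_le_sum) (auto intro: less_imp_le gibbs_specification_pos)

text \<open>Numerator and partition function each change by a factor of at most
  \<open>exp (\<epsilon> / 2)\<close>. The multiplicative form has two uses: with a fixed factor it
  bounds the specification from below, and with a factor near 1 it gives an absolute estimate, since
  the values are at most 1.\<close>

lemma gibbs_specification_oscillation: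
  fixes \<Phi> :: "('n::finite, 'x::finite) potential"
  assumes "uniformly_convergent_potential \<Phi>" "\<epsilon> > 0"
  shows "\<exists>L. finite L \<and> L \<subseteq> - {t} \<and> (\<forall>x\<in>configs {t}. \<forall>b\<in>configs (- {t}). \<forall>b'\<in>configs (- {t}).
    (\<forall>i\<in>L. b i = b' i) \<longrightarrow> gibbs_specification \<Phi> {t} b x \<le> exp \<epsilon> * gibbs_specification \<Phi> {t} b' x)"
proof -
  obtain L where L: "finite L" "L \<subseteq> - {t}"
    and osc: "\<And>x b b'. x \<in> configs {t} \<Longrightarrow> b \<in> configs (- {t}) \<Longrightarrow> b' \<in> configs (- {t}) \<Longrightarrow>
      (\<forall>i\<in>L. b i = b' i) \<Longrightarrow> \<bar>gibbs_energy \<Phi> {t} b x - gibbs_energy \<Phi> {t} b' x\<bar> \<le> \<epsilon> / 2"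
    using energy_oscillation[OF assms(1), of "\<epsilon> / 2" t] assms(2) by (metis half_gt_zero)
  have "gibbs_specification \<Phi> {t} b x \<le> exp \<epsilon> * gibbs_specification \<Phi> {t} b' x"
    if x: "x \<in> configs {t}" and b: "b \<in> configs (- {t})" "b' \<in> configs (- {t})" "\<forall>i\<in>L. b i = b' i" for x b b'
  proof -
    have le: "exp (- gibbs_energy \<Phi> {t} c y) \<le> exp (\<epsilon> / 2) * exp (- gibbs_energy \<Phi> {t} c' y)"
      if "y \<in> configs {t}" "c \<in> configs (- {t})" "c' \<in> configs (- {t})" "\<forall>i\<in>L. c i = c' i" for y c c'
    proof -
      have "- gibbs_energy \<Phi> {t} c y \<le> \<epsilon> / 2 + - gibbs_energy \<Phi> {t} c' y"
        using osc[OF that] by linarith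
      then show ?thesis by (simp flip: exp_add)
    qed
    define Z where "Z = (\<lambda>c. \<Sum>y\<in>configs {t}. exp (- gibbs_energy \<Phi> {t} c y))"
    have gibbs: "gibbs_specification \<Phi> {t} c x = exp (- gibbs_energy \<Phi> {t} c x) / Z c" for c
      by (simp add: gibbs_specification_def Z_def)
    have "Z b' \<le> exp (\<epsilon> / 2) * Z b"
      unfolding Z_def sum_distrib_left by (rule sum_mono) (use b in \<open>auto intro!: le\<close>)
    moreover have pos: "Z b > 0" "Z b' > 0"
      unfolding Z_def by (intro partition_function_pos; simp)+
    ultimately have "exp (- gibbs_energy \<Phi> {t} b x) * Z b'
        \<le> (exp (\<epsilon> / 2) * exp (- gibbs_energy \<Phi> {t} b' x)) * (exp (\<epsilon> / 2) * Z b)"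
      using le[OF x b] by (intro mult_mono) auto
    also have "\<dots> = (exp (\<epsilon> / 2) * exp (\<epsilon> / 2)) * exp (- gibbs_energy \<Phi> {t} b' x) * Z b"
      by (simp add: mult_ac)
    also have "exp (\<epsilon> / 2) * exp (\<epsilon> / 2) = exp \<epsilon>"
      by (simp flip: exp_add)
    finally show ?thesis
      using pos gibbs by (simp add: field_simps)
  qed
  then show ?thesis using L by blast
qed

section \<open>Cylinder probabilities as averages of the conditional distribution\<close>

context
  fixes P :: "('n::finite, 'x::finite) config measure"
  assumes field: "random_field P"
begin

interpretation prob_space P
  using field by (simp add: random_field_def)

text \<open>By monotonicity a null cylinder has only null extensions, so division by 0 does no harm
  and the product rule is available before positivity of \<open>P\<close> is known.\<close>

lemma site_cond_bounds:
  assumes "finite J" "t \<notin> J"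
  shows "0 \<le> site_cond P t a J z" "site_cond P t a J z \<le> 1"
    "site_cond P t a J z * cyl_prob P J z = cyl_prob P (insert t J) (z(t := a))"
proof -
  have "cyl_prob P J (z(t := a)) = cyl_prob P J z"
    using assms by (intro cyl_prob_cong) auto
  then have le: "cyl_prob P (insert t J) (z(t := a)) \<le> cyl_prob P J z"
    using cyl_prob_mono[OF field assms(1), of "insert t J" "z(t := a)"] by auto
  have nn: "cyl_prob P (insert t J) (z(t := a)) \<ge> 0" "cyl_prob P J z \<ge> 0"
    by (simp_all add: cyl_prob_nonneg[OF field])
  show "0 \<le> site_cond P t a J z" "site_cond P t a J z \<le> 1"
    "site_cond P t a J z * cyl_prob P J z = cyl_prob P (insert t J) (z(t := a))"
    using le nn by (auto simp: site_cond_def divide_le_eq_1)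
qed

lemma local_integrable:
  fixes F :: "('n, 'x) config \<Rightarrow> real"
  assumes "finite D" "local_on D F"
  shows "integrable P F"
proof -
  obtain B where "\<And>z. \<bar>F z\<bar> \<le> B" using local_bounded[OF assms] by blast
  then show ?thesis
    by (intro integrable_const_bound[of _ B] local_measurable[OF field assms]) auto
qed

text \<open>Dominated convergence is applied to the clipped deviation \<open>h\<close>, whose almost sure limit
  is 0, so that \<open>Q\<close> need not be measurable.\<close>
lemma cond_average:
  assumes ver: "cond_distribution_version P Q" and x: "x \<in> configs {t}"
    and J: "finite J" "t \<notin> J"
    and close: "\<And>b. b \<in> configs (- {t}) \<Longrightarrow> (\<And>i. i \<in> J \<Longrightarrow> b i = z i) \<Longrightarrow> \<bar>Q {t} b x - c\<bar> \<le> \<delta>"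
  shows "\<bar>cyl_prob P (insert t J) (z(t := x t)) - c * cyl_prob P J z\<bar> \<le> \<delta> * cyl_prob P J z"
proof -
  \<comment> \<open>An exhaustion of the complement of \<open>t\<close> that contains
    \<open>J\<close> from the start, so that the indicator of the cylinder over \<open>J\<close> is
    local on every \<open>D n\<close>.\<close>
  define D where "D n = J \<union> (from_nat_into UNIV ` {..n} - {t})" for n :: nat
  have D: "incseq D" "\<And>n. finite (D n)" "\<And>n. t \<notin> D n" "\<And>n. J \<subseteq> D n"
    using J by (auto simp: D_def incseq_def)
  have "s \<in> (\<Union>n. D n)" if "s \<noteq> t" for s
  proof -
    obtain n where "from_nat_into UNIV n = s"
      by (metis UNIV_I from_nat_into_surj countableI_type)
    then show ?thesis using that by (auto simp: D_def)
  qed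
  then have UN: "(\<Union>n. D n) = - {t}" using D(3) by auto
  define f where "f n w = site_cond P t (x t) (D n) w" for n w
  define I where "I = (indicator {w. \<forall>i\<in>J. w i = z i} :: ('n, 'x) config \<Rightarrow> real)"
  define h where "h n w = I w * max 0 (\<bar>f n w - c\<bar> - \<delta>)" for n w
  have loc_f: "local_on (D n) (f n)" for n
    by (auto intro!: local_onI site_cond_cong simp: f_def)
  have loc_I: "local_on (D n) I" for n
  proof (rule local_onI)
    fix w w' :: "('n, 'x) config" assume "\<And>i. i \<in> D n \<Longrightarrow> w i = w' i"
    then have "(\<forall>i\<in>J. w i = z i) \<longleftrightarrow> (\<forall>i\<in>J. w' i = z i)" using D(4)[of n] by (metis subsetD)
    then show "I w = I w'" by (simp add: I_def indicator_def)
  qed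
  have loc_h: "local_on (D n) (h n)" for n
    unfolding h_def[abs_def] by (rule local_on_combine[OF loc_I loc_f])
  have loc_If: "local_on (D n) (\<lambda>w. I w * f n w)" for n
    by (rule local_on_combine[OF loc_I loc_f])
  have f_bounds: "0 \<le> f n w" "f n w \<le> 1" for n w
    using site_cond_bounds[OF D(2,3)] by (auto simp: f_def)

  have "AE b in marginal P (- {t}). \<forall>x\<in>configs {t}.
      (\<lambda>n. marginal_prob P ({t} \<union> D n) (merge {t} (D n) (x, restrict b (D n)))
         / marginal_prob P (D n) (restrict b (D n))) \<longlonglongrightarrow> Q {t} b x"
    using ver D(1,2) UN unfolding cond_distribution_version_def by blast
  from AE_distrD[OF measurable_restrict_field[OF field] this[unfolded marginal_def]]
  have "AE w in P. (\<lambda>n. f n w) \<longlonglongrightarrow> Q {t} (restrict w (- {t})) x"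
  proof eventually_elim
    case (elim w)
    have "marginal_prob P ({t} \<union> D n) (merge {t} (D n) (x, restrict (restrict w (- {t})) (D n)))
         / marginal_prob P (D n) (restrict (restrict w (- {t})) (D n)) = f n w" for n
    proof -
      have "restrict (restrict w (- {t})) (D n) = restrict w (D n)"
        using D(3)[of n] by (auto simp: restrict_def fun_eq_iff)
      moreover have "one_point_cond P t (D n, restrict w (D n)) x = site_cond P t (x t) (D n) (restrict w (D n))"
        using x D by (intro one_point_cond_eq[OF field]) auto
      moreover have "\<dots> = f n w"
        using local_on_restrict[OF loc_f[of n], of w] by (simp add: f_def)
      ultimately show ?thesis by (simp add: one_point_cond_def)
    qed
    then show ?case using bspec[OF elim x] by presburger
  qed
  then have AE_h: "AE w in P. (\<lambda>n. h n w) \<longlonglongrightarrow> 0"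
  proof eventually_elim
    case (elim w)
    show ?case
    proof (cases "\<forall>i\<in>J. w i = z i")
      case True
      have "\<bar>Q {t} (restrict w (- {t})) x - c\<bar> \<le> \<delta>"
        using True J by (intro close) auto
      moreover have "(\<lambda>n. h n w) \<longlonglongrightarrow> I w * max 0 (\<bar>Q {t} (restrict w (- {t})) x - c\<bar> - \<delta>)"
        unfolding h_def by (intro tendsto_intros elim)
      ultimately show ?thesis by (simp add: max_def split: if_splits)
    next
      case False
      then have "I w = 0" by (auto simp: I_def)
      then show ?thesis by (simp add: h_def)
    qed
  qed
  have "(\<lambda>n. integral\<^sup>L P (h n)) \<longlonglongrightarrow> integral\<^sup>L P (\<lambda>_. 0)"
  proof (rule integral_dominated_convergence[where w = "\<lambda>_. 1 + \<bar>c\<bar> + \<bar>\<delta>\<bar>"])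
    show "AE w in P. norm (h n w) \<le> 1 + \<bar>c\<bar> + \<bar>\<delta>\<bar>" for n
      using f_bounds[of n] by (intro AE_I2) (auto simp: h_def I_def indicator_def abs_le_iff max_def, smt (verit))
  qed (use AE_h local_measurable[OF field D(2) loc_h] in auto)
  then have lim: "(\<lambda>n. \<delta> * cyl_prob P J z + integral\<^sup>L P (h n)) \<longlonglongrightarrow> \<delta> * cyl_prob P J z + 0"
    by (intro tendsto_intros) simp

  \<comment> \<open>The tower property: averaging the conditional probabilities given
    \<open>D n\<close> over the cylinder on \<open>J\<close> gives the same value for every
    \<open>n\<close>, so only \<open>h n\<close> has to be sent to the limit.\<close>
  have int_If: "integral\<^sup>L P (\<lambda>w. I w * f n w) = cyl_prob P (insert t J) (z(t := x t))" for n
  proof -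
    let ?A = "{w. \<forall>i\<in>insert t J. w i = (z(t := x t)) i}"
    have "cyl_prob P (insert t J) (z(t := x t)) = (\<Sum>y\<in>configs (D n). measure P (?A \<inter> {w. \<forall>i\<in>D n. w i = y i}))"
      unfolding cyl_prob_def
      using J D(2) by (intro measure_partition[OF field] cylinder_sets[OF field]) auto
    also have "\<dots> = (\<Sum>y\<in>configs (D n). I y * f n y * cyl_prob P (D n) y)"
    proof (intro sum.cong refl)
      fix y
      show "measure P (?A \<inter> {w. \<forall>i\<in>D n. w i = y i}) = I y * f n y * cyl_prob P (D n) y"
      proof (cases "\<forall>i\<in>J. y i = z i")
        case True
        then have "?A \<inter> {w. \<forall>i\<in>D n. w i = y i} = {w. \<forall>i\<in>insert t (D n). w i = (y(t := x t)) i}"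
          using J(2) D(3,4)[of n] by fastforce
        then have "measure P (?A \<inter> {w. \<forall>i\<in>D n. w i = y i}) = f n y * cyl_prob P (D n) y"
          using site_cond_bounds(3)[OF D(2,3)] by (simp add: f_def cyl_prob_def)
        then show ?thesis using True by (simp add: I_def)
      next
        case False
        then obtain i where i: "i \<in> J" "y i \<noteq> z i" by blast
        then have "i \<in> D n" "i \<noteq> t" using D(4)[of n] J by auto
        then have "?A \<inter> {w. \<forall>i\<in>D n. w i = y i} = {}" using i by force
        then show ?thesis using False by (auto simp: I_def)
      qed
    qed
    also have "\<dots> = integral\<^sup>L P (\<lambda>w. I w * f n w)"
      using local_integral[OF field D(2) loc_If] by simp
    finally show ?thesis by simp
  qed
  have int_I: "integral\<^sup>L P I = cyl_prob P J z"
    using cylinder_sets[OF field J(1), of z] by (simp add: I_def cyl_prob_def space_field[OF field])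
  note integrable = local_integrable[OF D(2) loc_If] local_integrable[OF D(2) loc_I]
    local_integrable[OF D(2) loc_h]
  have "\<bar>cyl_prob P (insert t J) (z(t := x t)) - c * cyl_prob P J z\<bar>
      \<le> \<delta> * cyl_prob P J z + integral\<^sup>L P (h n)" for n
  proof -
    have "cyl_prob P (insert t J) (z(t := x t)) - c * cyl_prob P J z
        = integral\<^sup>L P (\<lambda>w. I w * f n w - c * I w)"
      using integrable by (simp add: int_If int_I)
    also have "\<bar>\<dots>\<bar> \<le> integral\<^sup>L P (\<lambda>w. \<bar>I w * f n w - c * I w\<bar>)"
      by (rule integral_abs_bound)
    also have "\<dots> \<le> integral\<^sup>L P (\<lambda>w. \<delta> * I w + h n w)"
    proof (intro integral_mono)
      \<comment> \<open>On the cylinder the deviation of \<open>f n w\<close> from \<open>c\<close>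
        is at most \<open>\<delta>\<close> plus its excess \<open>h n w\<close>; off the cylinder
        both sides vanish.\<close>
      show "\<bar>I w * f n w - c * I w\<bar> \<le> \<delta> * I w + h n w" for w
        by (auto simp: h_def I_def indicator_def)
    qed (use integrable in auto)
    also have "\<dots> = \<delta> * cyl_prob P J z + integral\<^sup>L P (h n)"
      using integrable by (simp add: int_I)
    finally show ?thesis .
  qed
  then show ?thesis
    using LIMSEQ_le_const[OF lim] by auto
qed

text \<open>The infimum is one of reals, hence meaningful only for a nonempty set that is bounded
  below: conditional probabilities are bounded by 0, and a second site provides a support.\<close>

lemma uniformly_nonnull_iff:
  "uniformly_nonnull P \<longleftrightarrow>
    (\<forall>t a. \<exists>c>0. \<forall>J z. finite J \<and> t \<notin> J \<and> J \<noteq> {} \<longrightarrow> c \<le> site_cond P t a J z)"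
proof -
  have "((INF z\<in>outer_configs {t}. one_point_cond P t z (restrict (\<lambda>_. a) {t})) > 0)
    \<longleftrightarrow> (\<exists>c>0. \<forall>J z. finite J \<and> t \<notin> J \<and> J \<noteq> {} \<longrightarrow> c \<le> site_cond P t a J z)"
    (is "(INF z\<in>_. ?q z) > 0 \<longleftrightarrow> ?r") for t a
  proof
    have lower: "bdd_below (?q ` outer_configs {t})"
      by (intro bdd_belowI[of _ 0])
        (auto simp: outer_configs_iff one_point_cond_eq[OF field] site_cond_bounds)
    assume pos: "(INF z\<in>outer_configs {t}. ?q z) > 0"
    have "(INF z\<in>outer_configs {t}. ?q z) \<le> site_cond P t a J z"
      if "finite J" "t \<notin> J" "J \<noteq> {}" for J z
    proof -
      have "(INF z\<in>outer_configs {t}. ?q z) \<le> ?q (J, restrict z J)"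
        using that by (intro cINF_lower[OF lower]) (auto simp: outer_configs_iff)
      also have "\<dots> = site_cond P t a J (restrict z J)"
        using that by (simp add: one_point_cond_eq[OF field])
      also have "\<dots> = site_cond P t a J z" by (rule site_cond_cong) auto
      finally show ?thesis .
    qed
    then show ?r using pos by blast
  next
    assume ?r
    then obtain c where c: "c > 0" "\<And>J z. finite J \<Longrightarrow> t \<notin> J \<Longrightarrow> J \<noteq> {} \<Longrightarrow> c \<le> site_cond P t a J z"
      by blast
    have "infinite (- {t})" using infinite_sites[where 'n = 'n] by (simp add: finite_compl)
    then obtain s where "s \<in> - {t}" by (metis finite.emptyI equals0I)
    then have "({s}, restrict (\<lambda>_. undefined) {s}) \<in> (outer_configs {t} :: ('n, 'x) supp_config set)"
      by (auto simp: outer_configs_iff)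
    then have "(outer_configs {t} :: ('n, 'x) supp_config set) \<noteq> {}" by blast
    then have "c \<le> (INF z\<in>outer_configs {t}. ?q z)"
      by (intro cINF_greatest) (auto simp: outer_configs_iff one_point_cond_eq[OF field] intro!: c)
    then show "(INF z\<in>outer_configs {t}. ?q z) > 0" using c(1) by linarith
  qed
  then show ?thesis
    unfolding uniformly_nonnull_def configs_singleton_iff by simp
qed

text \<open>Up to the factor \<open>exp 1\<close> the one-site specification depends on the exterior
  only through a finite window, and there it takes finitely many positive values. The product form
  matters, since positivity of \<open>P\<close> is derived from this bound.\<close>

lemma gibbs_lower_bound:
  fixes \<Phi> :: "('n, 'x) potential"
  assumes ucp: "uniformly_convergent_potential \<Phi>"
    and ver: "cond_distribution_version P (gibbs_specification \<Phi>)"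
  shows "\<exists>c>0. \<forall>J z. finite J \<and> t \<notin> J \<longrightarrow> c * cyl_prob P J z \<le> cyl_prob P (insert t J) (z(t := a))"
proof -
  define x where "x = restrict (\<lambda>_. a) {t}"
  have x: "x \<in> configs {t}" "x t = a" by (auto simp: x_def)
  let ?Q = "\<lambda>b. gibbs_specification \<Phi> {t} b x"
  obtain L where L: "finite L" "L \<subseteq> - {t}" and osc: "\<And>b b'. b \<in> configs (- {t}) \<Longrightarrow> b' \<in> configs (- {t}) \<Longrightarrow>
    (\<forall>i\<in>L. b i = b' i) \<Longrightarrow> ?Q b \<le> exp 1 * ?Q b'"
    using gibbs_specification_oscillation[OF ucp zero_less_one, of t] x(1) by metis
  \<comment> \<open>A representative exterior: \<open>z\<close> on the window \<open>L\<close>, the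
    fixed state \<open>undefined\<close> elsewhere.\<close>
  define rep :: "('n, 'x) config \<Rightarrow> ('n, 'x) config"
    where "rep z = restrict (override_on (\<lambda>_. undefined) z L) (- {t})" for z
  have "local_on L (\<lambda>z. ?Q (rep z))"
    by (intro local_onI arg_cong[where f = ?Q]) (auto simp: rep_def restrict_def override_on_def fun_eq_iff)
  from local_pos_lower_bound[OF L(1) this] obtain c where c: "c > 0" "\<And>z. c \<le> ?Q (rep z)"
    using gibbs_specification_pos[of "{t}" \<Phi> _ x] by auto
  define d where "d = exp (-1) * c"
  have d: "d > 0" using c(1) by (simp add: d_def)
  have lower: "d \<le> ?Q b" if "b \<in> configs (- {t})" for b
  proof -
    have "c \<le> exp 1 * ?Q b"
      using c(2)[of b] osc[of "rep b" b] that L(2)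
      by (force simp: rep_def)
    then have "exp (-1) * c \<le> exp (-1) * (exp 1 * ?Q b)" by (intro mult_left_mono) auto
    also have "\<dots> = ?Q b" by (simp add: exp_minus)
    finally show ?thesis by (simp add: d_def)
  qed
  have "d * cyl_prob P J z \<le> cyl_prob P (insert t J) (z(t := a))" if J: "finite J" "t \<notin> J" for J z
  proof -
    \<comment> \<open>The interval from \<open>d\<close> to 1, which contains all values of the
      specification, is written by its centre and radius; their difference is the lower end
      \<open>d\<close>.\<close>
    have "\<bar>cyl_prob P (insert t J) (z(t := x t)) - (1 + d) / 2 * cyl_prob P J z\<bar>
        \<le> (1 - d) / 2 * cyl_prob P J z"
    proof (rule cond_average[OF ver x(1) J])
      fix b :: "('n, 'x) config" assume "b \<in> configs (- {t})"
      then show "\<bar>?Q b - (1 + d) / 2\<bar> \<le> (1 - d) / 2"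
        using lower[of b] gibbs_specification_le_1[of "{t}" x \<Phi> b] x(1) by (simp add: abs_le_iff field_simps)
    qed
    then show ?thesis using x(2) by (simp add: abs_le_iff field_simps)
  qed
  then show ?thesis using d by blast
qed

text \<open>Each further site multiplies the probability of a cylinder by at least a positive
  constant, starting from probability 1 for the empty window.\<close>

lemma gibbs_imp_positive:
  assumes "gibbs_random_field P"
  shows "strictly_positive P"
proof -
  obtain \<Phi> :: "('n, 'x) potential" where ucp: "uniformly_convergent_potential \<Phi>"
    and ver: "cond_distribution_version P (gibbs_specification \<Phi>)"
    using assms by (auto simp: gibbs_random_field_def)
  have "\<forall>z. cyl_prob P W z > 0" if "finite W" for W
    using that
  proof induction
    case empty
    then show ?case by (simp add: cyl_prob_empty[OF field])
  next
    case (insert t W)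
    show ?case
    proof
      fix z
      obtain c where "c > 0" "c * cyl_prob P W z \<le> cyl_prob P (insert t W) (z(t := z t))"
        using gibbs_lower_bound[OF ucp ver, of t "z t"] insert.hyps by blast
      moreover have "c * cyl_prob P W z > 0" using insert.IH \<open>c > 0\<close> by simp
      ultimately show "cyl_prob P (insert t W) z > 0" by simp
    qed
  qed
  then show ?thesis by (simp add: strictly_positive_iff[OF field])
qed

lemma gibbs_imp_nonnull:
  assumes "gibbs_random_field P"
  shows "uniformly_nonnull P"
  unfolding uniformly_nonnull_iff
proof (intro allI)
  fix t :: "'n site" and a :: 'x
  obtain \<Phi> :: "('n, 'x) potential" where ucp: "uniformly_convergent_potential \<Phi>"
    and ver: "cond_distribution_version P (gibbs_specification \<Phi>)"
    using assms by (auto simp: gibbs_random_field_def)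
  obtain c where "c > 0"
    "\<And>J z. finite J \<Longrightarrow> t \<notin> J \<Longrightarrow> c * cyl_prob P J z \<le> cyl_prob P (insert t J) (z(t := a))"
    using gibbs_lower_bound[OF ucp ver, of t a] by metis
  then show "\<exists>c>0. \<forall>J z. finite J \<and> t \<notin> J \<and> J \<noteq> {} \<longrightarrow> c \<le> site_cond P t a J z"
    using gibbs_imp_positive[OF assms]
    by (intro exI[of _ c]) (auto simp: site_cond_def strictly_positive_iff[OF field] le_divide_eq)
qed

lemma gibbs_imp_cond_C:
  assumes "gibbs_random_field P"
  shows "cond_C P"
  unfolding cond_C_iff[OF field] window_C_def
proof (intro allI impI)
  fix t :: "'n site" and a :: 'x and \<epsilon> :: real assume \<epsilon>: "\<epsilon> > 0"
  obtain \<Phi> :: "('n, 'x) potential" where ucp: "uniformly_convergent_potential \<Phi>"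
    and ver: "cond_distribution_version P (gibbs_specification \<Phi>)"
    using assms by (auto simp: gibbs_random_field_def)
  define x where "x = restrict (\<lambda>_. a) {t}"
  have x: "x \<in> configs {t}" "x t = a" by (auto simp: x_def)
  let ?Q = "\<lambda>b. gibbs_specification \<Phi> {t} b x"
  \<comment> \<open>With this exponent the ratio is at most \<open>1 + \<epsilon> / 2\<close>, which
    for values not exceeding 1 is an absolute difference of at most
    \<open>\<epsilon> / 2\<close>.\<close>
  obtain K where K: "finite K" "K \<subseteq> - {t}" and osc: "\<And>b b'. b \<in> configs (- {t}) \<Longrightarrow> b' \<in> configs (- {t}) \<Longrightarrow>
    (\<forall>i\<in>K. b i = b' i) \<Longrightarrow> ?Q b \<le> exp (ln (1 + \<epsilon> / 2)) * ?Q b'"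
    using gibbs_specification_oscillation[OF ucp, of "ln (1 + \<epsilon> / 2)" t] x(1) \<epsilon> by auto
  have close: "\<bar>?Q b - ?Q b'\<bar> \<le> \<epsilon> / 2"
    if "b \<in> configs (- {t})" "b' \<in> configs (- {t})" "\<forall>i\<in>K. b i = b' i" for b b'
  proof -
    have *: "?Q c - ?Q c' \<le> \<epsilon> / 2"
      if c: "c \<in> configs (- {t})" "c' \<in> configs (- {t})" "\<forall>i\<in>K. c i = c' i" for c c'
    proof -
      have "?Q c \<le> (1 + \<epsilon> / 2) * ?Q c'" using osc[OF c] \<epsilon> by simp
      moreover have "\<epsilon> / 2 * ?Q c' \<le> \<epsilon> / 2 * 1"
        using \<epsilon> gibbs_specification_le_1[of "{t}" x \<Phi> c'] x(1) by (intro mult_left_mono) auto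
      ultimately show ?thesis by (simp add: algebra_simps)
    qed
    have "\<forall>i\<in>K. b' i = b i" using that by simp
    then show ?thesis using *[OF that] *[OF that(2,1)] by linarith
  qed
  \<comment> \<open>All exteriors that extend \<open>z\<close> from \<open>J\<close> agree with
    \<open>b\<close> on \<open>K\<close>, so the specification is nearly constant on the cylinder,
    and so is its average.\<close>
  have near: "\<bar>site_cond P t a J z - ?Q b\<bar> \<le> \<epsilon> / 2"
    if J: "finite J" "t \<notin> J" "K \<subseteq> J" and b: "b \<in> configs (- {t})" "\<forall>i\<in>K. z i = b i" for J z b
  proof -
    have "\<bar>cyl_prob P (insert t J) (z(t := x t)) - ?Q b * cyl_prob P J z\<bar> \<le> \<epsilon> / 2 * cyl_prob P J z"
    proof (rule cond_average[OF ver x(1) J(1,2)])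
      fix b' :: "('n, 'x) config" assume "b' \<in> configs (- {t})" "\<And>i. i \<in> J \<Longrightarrow> b' i = z i"
      then show "\<bar>?Q b' - ?Q b\<bar> \<le> \<epsilon> / 2"
        using b J(3) by (intro close) auto
    qed
    moreover have "cyl_prob P J z > 0"
      using gibbs_imp_positive[OF assms] J(1) by (simp add: strictly_positive_iff[OF field])
    ultimately show ?thesis using x(2) by (simp add: site_cond_def abs_le_iff field_simps)
  qed
  show "\<forall>\<^sub>F L in finite_subsets_at_top (- {t}). \<forall>J J' z z'.
      finite J \<and> finite J' \<and> t \<notin> J \<and> t \<notin> J' \<and> L \<subseteq> J \<and> L \<subseteq> J' \<and> (\<forall>i\<in>L. z i = z' i)
       \<longrightarrow> \<bar>site_cond P t a J z - site_cond P t a J' z'\<bar> \<le> \<epsilon>"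
    unfolding eventually_finite_subsets_at_top
  proof (intro exI[of _ K] conjI K allI impI)
    fix L J J' and z z' :: "('n, 'x) config"
    assume L: "finite L \<and> K \<subseteq> L \<and> L \<subseteq> - {t}" and
      J: "finite J \<and> finite J' \<and> t \<notin> J \<and> t \<notin> J' \<and> L \<subseteq> J \<and> L \<subseteq> J' \<and> (\<forall>i\<in>L. z i = z' i)"
    \<comment> \<open>The same exterior, cut out of \<open>z\<close>, serves both windows:
      \<open>z'\<close> matches it on \<open>K\<close> as well.\<close>
    have "\<forall>i\<in>K. z i = restrict z (- {t}) i" "\<forall>i\<in>K. z' i = restrict z (- {t}) i"
      using L J K by auto
    then have "\<bar>site_cond P t a J z - ?Q (restrict z (- {t}))\<bar> \<le> \<epsilon> / 2"
      "\<bar>site_cond P t a J' z' - ?Q (restrict z (- {t}))\<bar> \<le> \<epsilon> / 2"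
      using L J near[of J "restrict z (- {t})" z] near[of J' "restrict z (- {t})" z'] by auto
    then show "\<bar>site_cond P t a J z - site_cond P t a J' z'\<bar> \<le> \<epsilon>" by linarith
  qed
qed

end

section \<open>Construction of a potential\<close>

lemma has_sum_finite_sum:
  fixes f :: "'i \<Rightarrow> 'a \<Rightarrow> 'b::topological_comm_monoid_add"
  assumes "finite I" "\<And>i. i \<in> I \<Longrightarrow> (f i has_sum s i) A"
  shows "((\<lambda>x. \<Sum>i\<in>I. f i x) has_sum (\<Sum>i\<in>I. s i)) A"
  using assms by (induction I rule: finite_induct) (auto intro: has_sum_add)

lemma incseq_covers_finite:
  assumes "incseq D" "finite A" "A \<subseteq> (\<Union>j. D j)"
  shows "\<exists>j0. \<forall>j\<ge>j0. A \<subseteq> D j"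
  using assms(2,3)
proof induction
  case (insert a A)
  then obtain j0 j1 where "\<forall>j\<ge>j0. A \<subseteq> D j" "a \<in> D j1" by auto
  then show ?case
    using assms(1) by (intro exI[of _ "max j0 j1"]) (auto dest: incseqD)
qed auto

lemma finite_subset_initial_segment:
  fixes e :: "nat \<Rightarrow> 'a"
  assumes "bij e" "finite A"
  shows "\<exists>k. A \<subseteq> e ` {..k}"
proof -
  have "incseq (\<lambda>k. e ` {..k})" by (auto simp: incseq_def)
  moreover have "A \<subseteq> (\<Union>k. e ` {..k})"
    using bij_is_surj[OF assms(1)] by (auto simp: surj_def) (metis atMost_iff imageI order_refl)
  ultimately show ?thesis using incseq_covers_finite[of "\<lambda>k. e ` {..k}" A] assms(2) by blast
qed

text \<open>Telescoping along windows on which the function has nearly converged: the increments are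
  supported on the blocks \<open>e ` {n..k m}\<close>, with summable norms.\<close>
lemma block_expansion:
  fixes F :: "'n::finite site set \<Rightarrow> ('n, 'x::finite) config \<Rightarrow> real" and e :: "nat \<Rightarrow> 'n site"
  assumes e: "bij e"
    and loc: "\<And>W. local_on (W \<inter> e ` {n..}) (F W)"
    and cauchy: "\<And>\<epsilon>. \<epsilon> > 0 \<Longrightarrow> \<exists>k. \<forall>W W' z. finite W \<and> finite W' \<and> e ` {..k} \<subseteq> W \<and> e ` {..k} \<subseteq> W'
      \<longrightarrow> \<bar>F W z - F W' z\<bar> \<le> \<epsilon>"
  shows "\<exists>\<phi> M. (\<forall>S z. \<phi> S z \<noteq> 0 \<longrightarrow> finite S \<and> e n \<in> S \<and> S \<subseteq> e ` {n..}) \<and>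
    (\<forall>S. local_on S (\<phi> S)) \<and> (\<forall>S z. \<bar>\<phi> S z\<bar> \<le> M S) \<and> M summable_on UNIV \<and>
    (\<forall>z D. incseq D \<longrightarrow> (\<forall>j. finite (D j)) \<longrightarrow> (\<Union>j. D j) = UNIV \<longrightarrow>
      (\<lambda>j. F (D j) z) \<longlonglongrightarrow> (\<Sum>\<^sub>\<infinity>S. \<phi> S z))"
proof -
  have "\<forall>m. \<exists>k. \<forall>W W' z. finite W \<and> finite W' \<and> e ` {..k} \<subseteq> W \<and> e ` {..k} \<subseteq> W'
      \<longrightarrow> \<bar>F W z - F W' z\<bar> \<le> (1/2) ^ m"
    by (intro allI cauchy) simp
  then obtain k0 where k0: "\<And>m W W' z. finite W \<Longrightarrow> finite W' \<Longrightarrow> e ` {..k0 m} \<subseteq> W \<Longrightarrow> e ` {..k0 m} \<subseteq> W'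
      \<Longrightarrow> \<bar>F W z - F W' z\<bar> \<le> (1/2) ^ m"
    by metis
  \<comment> \<open>The sum of all earlier \<open>k0 i\<close> dominates \<open>k0 m\<close>, the
    term \<open>m\<close> makes \<open>k\<close> strictly increasing and hence the blocks distinct,
    and the term \<open>n\<close> puts \<open>e n\<close> into every block.\<close>
  define k where "k m = n + m + (\<Sum>i\<le>m. k0 i)" for m
  have k_mono: "strict_mono k"
    by (rule strict_monoI_Suc) (simp add: k_def)
  have k_ge: "n \<le> k m" "k0 m \<le> k m" for m
    using member_le_sum[of m "{..m}" k0] by (auto simp: k_def)
  have close: "\<bar>F W z - F W' z\<bar> \<le> (1/2) ^ m"
    if W: "finite W" "finite W'" "e ` {..k m} \<subseteq> W" "e ` {..k m} \<subseteq> W'" for m W W' z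
  proof -
    have "e ` {..k0 m} \<subseteq> e ` {..k m}" using k_ge(2)[of m] by auto
    then show ?thesis using W by (intro k0) auto
  qed
  define B where "B m = e ` {n..k m}" for m
  have B_inj: "inj B"
  proof (rule injI)
    fix m m' assume "B m = B m'"
    then have "{n..k m} = {n..k m'}"
      using e by (simp add: B_def inj_image_eq_iff bij_is_inj)
    then have "k m = k m'" using k_ge(1)[of m] k_ge(1)[of m'] by simp
    then show "m = m'" using k_mono by (simp add: strict_mono_eq)
  qed
  define T where "T m z = F (e ` {..k m}) z" for m z
  have T_loc: "local_on (B m) (T m)" for m
  proof -
    have "e ` {..k m} \<inter> e ` {n..} = e ` ({..k m} \<inter> {n..})"
      using e by (simp add: image_Int bij_is_inj)
    also have "{..k m} \<inter> {n..} = {n..k m}" by auto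
    finally show ?thesis using loc[of "e ` {..k m}"] by (simp add: B_def T_def[abs_def])
  qed
  \<comment> \<open>Increment 0 is the whole of \<open>T 0\<close>, so the partial sums are
    \<open>T m\<close> without an offset.\<close>
  define d where "d m z = (case m of 0 \<Rightarrow> T 0 z | Suc m' \<Rightarrow> T (Suc m') z - T m' z)" for m z
  have d_loc: "local_on (B m) (d m)" for m
  proof (rule local_onI)
    fix z z' :: "('n, 'x) config" assume eq: "\<And>i. i \<in> B m \<Longrightarrow> z i = z' i"
    have T_eq: "T l z = T l z'" if "l \<le> m" for l
    proof (rule local_onD[OF T_loc])
      fix i assume "i \<in> B l"
      moreover have "k l \<le> k m" using that k_mono by (simp add: strict_mono_less_eq)
      ultimately show "z i = z' i" using eq by (auto simp: B_def)
    qed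
    show "d m z = d m z'"
      using T_eq by (cases m) (simp_all add: d_def)
  qed
  have d_sum: "(\<Sum>i<Suc m. d i z) = T m z" for m z
    by (induction m) (simp_all add: d_def)
  obtain C where C: "\<And>z. \<bar>T 0 z\<bar> \<le> C"
    using local_bounded[OF _ T_loc[of 0]] by (auto simp: B_def)
  \<comment> \<open>The first bound is finite but not small; it comes from the finite range of
    \<open>T 0\<close>. Both windows of increment \<open>Suc m'\<close> contain window
    \<open>m'\<close>, whence the exponent \<open>m'\<close>.\<close>
  define \<mu> where "\<mu> m = (case m of 0 \<Rightarrow> \<bar>C\<bar> | Suc m' \<Rightarrow> (1/2::real) ^ m')" for m
  have d_le: "\<bar>d m z\<bar> \<le> \<mu> m" for m z
  proof (cases m)
    case 0
    then show ?thesis using C[of z] by (simp add: d_def \<mu>_def)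
  next
    case (Suc m')
    have "k m' \<le> k (Suc m')" using k_mono by (simp add: strict_mono_less_eq)
    then have "\<bar>T (Suc m') z - T m' z\<bar> \<le> (1/2) ^ m'"
      unfolding T_def by (intro close) auto
    then show ?thesis by (simp add: Suc d_def \<mu>_def)
  qed
  have \<mu>_nonneg: "\<mu> m \<ge> 0" for m by (simp add: \<mu>_def split: nat.split)
  have "summable (\<lambda>m. \<mu> (Suc m))" by (simp add: \<mu>_def summable_geometric)
  then have \<mu>_summable: "summable \<mu>" by (simp only: summable_Suc_iff)
  define G where "G z = (\<Sum>m. d m z)" for z
  have d_summable: "summable (\<lambda>m. norm (d m z))" for z
    by (rule summable_comparison_test'[OF \<mu>_summable, of 0]) (use d_le in auto)
  then have d_sums: "(\<lambda>m. d m z) sums G z" for z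
    unfolding G_def by (rule summable_sums[OF summable_norm_cancel])
  then have d_has_sum: "((\<lambda>m. d m z) has_sum G z) UNIV" for z
    by (intro norm_summable_imp_has_sum d_summable)
  have T_lim: "(\<lambda>m. T m z) \<longlonglongrightarrow> G z" for z
    using LIMSEQ_Suc[OF d_sums[of z, unfolded sums_def]] by (simp only: d_sum)
  \<comment> \<open>Transports a sequence from indices to blocks, with 0 on all other sets, because
    a potential is indexed by sets of sites.\<close>
  define lift :: "(nat \<Rightarrow> real) \<Rightarrow> 'n site set \<Rightarrow> real"
    where "lift g S = (if S \<in> range B then g (inv B S) else 0)" for g S
  have lift_B [simp]: "lift g (B m) = g m" for g m
    using B_inj by (simp add: lift_def)
  have lift_outside: "S \<notin> range B \<Longrightarrow> lift g S = 0" for g S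
    by (simp add: lift_def)
  have lift_has_sum: "(lift g has_sum s) UNIV" if "(g has_sum s) UNIV" for g s
  proof -
    have "(lift g has_sum s) (range B)"
      using that by (simp add: has_sum_reindex[OF B_inj] comp_def)
    then show ?thesis
      by (rule has_sum_cong_neutral[THEN iffD1, rotated -1]) (auto simp: lift_outside)
  qed
  define \<phi> where "\<phi> S z = lift (\<lambda>m. d m z) S" for S z
  show ?thesis
  proof (intro exI conjI allI impI)
    fix S z assume "\<phi> S z \<noteq> 0"
    then have "S \<in> range B" using lift_outside unfolding \<phi>_def by metis
    then obtain m where "S = B m" by blast
    then show "finite S" "e n \<in> S" "S \<subseteq> e ` {n..}" using k_ge(1)[of m] by (auto simp: B_def)
  next
    fix S
    show "local_on S (\<phi> S)"
    proof (cases "S \<in> range B")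
      case True
      then show ?thesis using d_loc by (auto simp: \<phi>_def[abs_def])
    qed (simp add: \<phi>_def[abs_def] lift_outside local_on_def)
  next
    fix S z
    show "\<bar>\<phi> S z\<bar> \<le> lift \<mu> S"
    proof (cases "S \<in> range B")
      case True
      then show ?thesis using d_le by (auto simp: \<phi>_def)
    qed (simp add: \<phi>_def lift_outside)
  next
    have "(\<mu> has_sum suminf \<mu>) UNIV"
      by (intro sums_nonneg_imp_has_sum summable_sums \<mu>_summable \<mu>_nonneg)
    then show "lift \<mu> summable_on UNIV"
      using lift_has_sum by (auto simp: summable_on_def)
  next
    fix z and D :: "nat \<Rightarrow> 'n site set"
    assume D: "incseq D" "\<forall>j. finite (D j)" "(\<Union>j. D j) = UNIV"
    have "(\<Sum>\<^sub>\<infinity>S. \<phi> S z) = G z"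
      unfolding \<phi>_def by (intro infsumI lift_has_sum d_has_sum)
    \<comment> \<open>\<open>D\<close> is an arbitrary exhaustion, so \<open>F (D j)\<close> is
      compared with \<open>T m\<close> for one large \<open>m\<close> as soon as \<open>D j\<close>
      has absorbed the window of \<open>T m\<close>.\<close>
    moreover have "(\<lambda>j. F (D j) z) \<longlonglongrightarrow> G z"
    proof (rule tendstoI)
      fix \<epsilon> :: real assume \<epsilon>: "\<epsilon> > 0"
      have "(\<lambda>m. (1/2) ^ m :: real) \<longlonglongrightarrow> 0" by (simp add: LIMSEQ_power_zero)
      then have "\<forall>\<^sub>F m in sequentially. (1/2) ^ m < \<epsilon> / 2"
        using \<epsilon> by (intro order_tendstoD(2)[where y = 0]) auto
      moreover have "\<forall>\<^sub>F m in sequentially. dist (T m z) (G z) < \<epsilon> / 2"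
        using \<epsilon> by (intro tendstoD[OF T_lim]) auto
      ultimately have "\<forall>\<^sub>F m in sequentially. (1/2) ^ m < \<epsilon> / 2 \<and> dist (T m z) (G z) < \<epsilon> / 2"
        by (rule eventually_conj)
      then obtain m where m: "(1/2) ^ m < \<epsilon> / 2" "dist (T m z) (G z) < \<epsilon> / 2"
        by (auto simp: eventually_sequentially)
      obtain j0 where j0: "\<forall>j\<ge>j0. e ` {..k m} \<subseteq> D j"
        using incseq_covers_finite[OF D(1), of "e ` {..k m}"] D(3) by auto
      have "dist (F (D j) z) (G z) < \<epsilon>" if "j \<ge> j0" for j
      proof -
        have "\<bar>F (D j) z - T m z\<bar> \<le> (1/2) ^ m"
          unfolding T_def using j0 that D(2) by (intro close) auto
        then show ?thesis using m unfolding dist_real_def by linarith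
      qed
      then show "\<forall>\<^sub>F j in sequentially. dist (F (D j) z) (G z) < \<epsilon>"
        unfolding eventually_sequentially by blast
    qed
    ultimately show "(\<lambda>j. F (D j) z) \<longlonglongrightarrow> (\<Sum>\<^sub>\<infinity>S. \<phi> S z)" by simp
  qed
qed

section \<open>Erasing one site at a time\<close>

text \<open>The state \<open>undefined\<close> plays the role of the vacuum.\<close>
definition erase :: "(nat \<Rightarrow> 'n site) \<Rightarrow> nat \<Rightarrow> ('n, 'x) config \<Rightarrow> ('n::finite, 'x::finite) config"
  where "erase e n z = override_on z (\<lambda>_. undefined) (e ` {..<n})"

text \<open>The version of g_n in the window \<open>W\<close>. As a difference of consecutive log
  probabilities it telescopes in \<open>n\<close>.\<close>

definition log_step ::
    "('n::finite, 'x::finite) config measure \<Rightarrow> (nat \<Rightarrow> 'n site) \<Rightarrow> nat \<Rightarrow> 'n site set \<Rightarrow> ('n, 'x) config \<Rightarrow> real"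
  where "log_step P e n W z = ln (cyl_prob P W (erase e n z)) - ln (cyl_prob P W (erase e (Suc n) z))"

lemma erase_0: "erase e 0 z = z"
  by (simp add: erase_def)

lemma erase_Suc: "erase e (Suc n) z = (erase e n z)(e n := undefined)"
  by (auto simp: erase_def override_on_def lessThan_Suc fun_eq_iff)

lemma erase_self:
  assumes "inj e"
  shows "(erase e n z)(e n := z (e n)) = erase e n z"
  using assms by (auto simp: erase_def override_on_def inj_eq fun_eq_iff)

lemma log_step_local:
  assumes "bij e"
  shows "local_on (W \<inter> e ` {n..}) (log_step P e n W)"
proof (rule local_onI)
  fix z z' :: "('a, 'b) config" assume eq: "\<And>i. i \<in> W \<inter> e ` {n..} \<Longrightarrow> z i = z' i"
  have "erase e n z i = erase e n z' i" if "i \<in> W" for i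
  proof -
    obtain m where "i = e m" using bij_is_surj[OF assms] by blast
    then show ?thesis
      using eq[of i] that by (cases "m < n") (auto simp: erase_def override_on_def)
  qed
  then show "log_step P e n W z = log_step P e n W z'"
    unfolding log_step_def erase_Suc by (intro arg_cong2[where f = "(-)"] arg_cong[where f = ln] cyl_prob_cong) auto
qed

lemma ln_lipschitz:
  fixes x y c :: real
  assumes "c > 0" "c \<le> x" "c \<le> y"
  shows "\<bar>ln x - ln y\<bar> \<le> \<bar>x - y\<bar> / c"
proof -
  have *: "ln u - ln v \<le> \<bar>u - v\<bar> / c" if "c \<le> u" "c \<le> v" for u v
  proof -
    have "ln u - ln v = ln (u / v)" using that assms(1) by (simp add: ln_div)
    also have "\<dots> \<le> u / v - 1" using that assms(1) by (intro ln_le_minus_one) auto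
    also have "\<dots> = (u - v) / v" using that assms(1) by (simp add: field_simps)
    also have "\<dots> \<le> \<bar>u - v\<bar> / v" using that assms(1) by (intro divide_right_mono) auto
    also have "\<dots> \<le> \<bar>u - v\<bar> / c" using that assms(1) by (intro divide_left_mono) auto
    finally show ?thesis .
  qed
  show ?thesis using *[of x y] *[of y x] assms by (simp add: abs_le_iff abs_minus_commute)
qed

section \<open>Convergence of the erasure costs and assembly of the potential\<close>

context
  fixes P :: "('n::finite, 'x::finite) config measure" and e :: "nat \<Rightarrow> 'n site"
  assumes field: "random_field P"
    and pos: "\<And>W z. finite W \<Longrightarrow> cyl_prob P W z > 0"
    and nonnull: "uniformly_nonnull P"
    and window: "window_C P"
    and e: "bij e"
begin

text \<open>Both cylinder probabilities split off the same factor over \<open>W - {e n}\<close>.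
  What remains are the log odds of the state at \<open>e n\<close> against the vacuum, to which (C)
  and nonnullness apply.\<close>

lemma log_step_eq:
  assumes "finite W" "e n \<in> W"
  shows "log_step P e n W z = ln (site_cond P (e n) (z (e n)) (W - {e n}) (erase e n z))
    - ln (site_cond P (e n) undefined (W - {e n}) (erase e n z))"
proof -
  let ?J = "W - {e n}" and ?z = "erase e n z"
  have J: "finite ?J" "e n \<notin> ?J" "insert (e n) ?J = W" using assms by auto
  have q: "site_cond P (e n) (z (e n)) ?J ?z * cyl_prob P ?J ?z = cyl_prob P W ?z"
    "site_cond P (e n) undefined ?J ?z * cyl_prob P ?J ?z = cyl_prob P W (erase e (Suc n) z)"
    using site_cond_bounds(3)[OF field J(1,2)]
    by (simp_all add: assms insert_absorb erase_Suc erase_self[OF bij_is_inj[OF e]])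
  have sc: "site_cond P (e n) a ?J ?z > 0" for a
    unfolding site_cond_def using J by (intro divide_pos_pos pos) auto
  show ?thesis
    unfolding log_step_def q[symmetric]
    using pos[OF J(1), of ?z] sc[of "z (e n)"] sc[of undefined] by (simp add: ln_mult)
qed

lemma log_step_cauchy:
  assumes "\<epsilon> > 0"
  shows "\<exists>k. \<forall>W W' z. finite W \<and> finite W' \<and> e ` {..k} \<subseteq> W \<and> e ` {..k} \<subseteq> W'
      \<longrightarrow> \<bar>log_step P e n W z - log_step P e n W' z\<bar> \<le> \<epsilon>"
proof -
  let ?t = "e n"
  have "\<forall>a. \<exists>c>0. \<forall>J z. finite J \<and> ?t \<notin> J \<and> J \<noteq> {} \<longrightarrow> c \<le> site_cond P ?t a J z"
    using nonnull unfolding uniformly_nonnull_iff[OF field] by simp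
  then obtain c0 where c0: "\<And>a. c0 a > 0"
    "\<And>a J z. finite J \<Longrightarrow> ?t \<notin> J \<Longrightarrow> J \<noteq> {} \<Longrightarrow> c0 a \<le> site_cond P ?t a J z"
    by metis
  define c where "c = Min (range c0)"
  have c: "c > 0" "c \<le> c0 a" for a using c0(1) by (auto simp: c_def)
  \<comment> \<open>Two logarithms are compared, each with Lipschitz constant \<open>1 / c\<close>;
    hence this tolerance.\<close>
  have "\<epsilon> / 2 * c > 0" using assms c(1) by simp
  then have "\<forall>\<^sub>F L in finite_subsets_at_top (- {?t}). \<forall>a.
      \<forall>J J' z z'. finite J \<and> finite J' \<and> ?t \<notin> J \<and> ?t \<notin> J' \<and> L \<subseteq> J \<and> L \<subseteq> J' \<and> (\<forall>i\<in>L. z i = z' i)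
       \<longrightarrow> \<bar>site_cond P ?t a J z - site_cond P ?t a J' z'\<bar> \<le> \<epsilon> / 2 * c"
    by (intro eventually_all_finite window[unfolded window_C_def, rule_format])
  from eventually_conj[OF this eventually_nonempty_window[of ?t]]
  obtain L where L: "finite L" "L \<subseteq> - {?t}" "L \<noteq> {}"
    and osc: "\<And>a J J' z z'. finite J \<Longrightarrow> finite J' \<Longrightarrow> ?t \<notin> J \<Longrightarrow> ?t \<notin> J' \<Longrightarrow> L \<subseteq> J \<Longrightarrow> L \<subseteq> J'
       \<Longrightarrow> (\<forall>i\<in>L. z i = z' i) \<Longrightarrow> \<bar>site_cond P ?t a J z - site_cond P ?t a J' z'\<bar> \<le> \<epsilon> / 2 * c"
    unfolding eventually_finite_subsets_at_top by (metis (no_types, lifting) subset_refl)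
  \<comment> \<open>The initial segment must also contain \<open>e n\<close> itself, since the log
    odds formula requires it in the window.\<close>
  obtain k where k: "insert ?t L \<subseteq> e ` {..k}"
    using finite_subset_initial_segment[OF e, of "insert ?t L"] L by auto
  show ?thesis
  proof (intro exI allI impI)
    fix W W' and z :: "('n, 'x) config"
    assume W: "finite W \<and> finite W' \<and> e ` {..k} \<subseteq> W \<and> e ` {..k} \<subseteq> W'"
    let ?J = "W - {?t}" and ?J' = "W' - {?t}" and ?z = "erase e n z"
    have J: "finite ?J" "finite ?J'" "?t \<notin> ?J" "?t \<notin> ?J'" "L \<subseteq> ?J" "L \<subseteq> ?J'"
      using W L k by auto
    then have "?J \<noteq> {}" "?J' \<noteq> {}" using L(3) by blast+
    note J = J this
    have near: "\<bar>ln (site_cond P ?t a ?J ?z) - ln (site_cond P ?t a ?J' ?z)\<bar> \<le> \<epsilon> / 2" for a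
    proof -
      have "\<bar>ln (site_cond P ?t a ?J ?z) - ln (site_cond P ?t a ?J' ?z)\<bar>
          \<le> \<bar>site_cond P ?t a ?J ?z - site_cond P ?t a ?J' ?z\<bar> / c"
        using J by (intro ln_lipschitz c(1) order_trans[OF c(2)[of a] c0(2)])
      also have "\<dots> \<le> (\<epsilon> / 2 * c) / c"
        using J c(1) by (intro divide_right_mono osc) auto
      finally show ?thesis using c(1) by simp
    qed
    have t: "?t \<in> W" "?t \<in> W'" using W k by auto
    show "\<bar>log_step P e n W z - log_step P e n W' z\<bar> \<le> \<epsilon>"
      using near[of "z ?t"] near[of undefined] log_step_eq[of W n z] log_step_eq[of W' n z] W t by linarith
  qed
qed

lemma cyl_prob_log_steps:
  assumes "finite W"
  shows "cyl_prob P W z = exp (\<Sum>n<N. log_step P e n W z) * cyl_prob P W (erase e N z)"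
proof -
  have "(\<Sum>n<N. log_step P e n W z) = ln (cyl_prob P W z) - ln (cyl_prob P W (erase e N z))"
    unfolding log_step_def
    using sum_lessThan_telescope'[of "\<lambda>n. ln (cyl_prob P W (erase e n z))" N] by (simp add: erase_0)
  then show ?thesis
    using pos[OF assms, of z] pos[OF assms, of "erase e N z"] by (simp add: exp_diff)
qed

text \<open>Once the first \<open>N\<close> sites are erased, nothing is left of the configuration
  on \<open>L\<close>, so the remaining probability \<open>?E\<close> is the same for all states on
  \<open>L\<close> and cancels in the normalisation.\<close>

lemma cond_prob_log_steps:
  assumes "finite L" "finite D" "L \<inter> D = {}" "L \<subseteq> e ` {..<N}" "x \<in> configs L"
  shows "marginal_prob P (L \<union> D) (merge L D (x, restrict b D)) / marginal_prob P D (restrict b D)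
    = exp (\<Sum>n<N. log_step P e n (L \<union> D) (override_on b x L))
      / (\<Sum>y\<in>configs L. exp (\<Sum>n<N. log_step P e n (L \<union> D) (override_on b y L)))"
proof -
  let ?W = "L \<union> D" and ?E = "cyl_prob P (L \<union> D) (erase e N b)"
  let ?A = "\<lambda>y. exp (\<Sum>n<N. log_step P e n (L \<union> D) (override_on b y L))"
  have eq: "cyl_prob P ?W (override_on b y L) = ?A y * ?E" for y
  proof -
    have "erase e N (override_on b y L) = erase e N b"
      using assms(4) by (auto simp: erase_def override_on_def fun_eq_iff)
    then show ?thesis using assms cyl_prob_log_steps[of ?W "override_on b y L" N] by simp
  qed
  have "marginal_prob P ?W (merge L D (x, restrict b D)) = cyl_prob P ?W (merge L D (x, restrict b D))"
    using assms by (intro marginal_prob_eq[OF field]) (auto simp: configs_def merge_def PiE_iff extensional_def)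
  also have "\<dots> = cyl_prob P ?W (override_on b x L)"
    using assms(3) by (intro cyl_prob_cong) (auto simp: merge_def override_on_def)
  finally have num: "marginal_prob P ?W (merge L D (x, restrict b D)) = ?A x * ?E" by (simp add: eq)
  have "marginal_prob P D (restrict b D) = cyl_prob P D (restrict b D)"
    using assms by (intro marginal_prob_eq[OF field]) auto
  also have "\<dots> = cyl_prob P D b" by (intro cyl_prob_cong) auto
  also have "\<dots> = (\<Sum>y\<in>configs L. ?A y * ?E)"
    using cyl_prob_sum[OF field assms(1-3)] by (simp add: eq)
  also have "\<dots> = (\<Sum>y\<in>configs L. ?A y) * ?E" by (simp add: sum_distrib_right)
  finally have den: "marginal_prob P D (restrict b D) = (\<Sum>y\<in>configs L. ?A y) * ?E" .
  have "?E \<noteq> 0" using pos[of ?W "erase e N b"] assms by auto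
  then show ?thesis unfolding num den by simp
qed

text \<open>Conditional probabilities in finite windows are normalised exponentials of sums of
  \<open>log_step\<close> over \<open>n < N\<close>; the Gibbs weights turn out to be the same
  expressions with the limits \<open>G n\<close>. As \<open>N\<close> depends only on
  \<open>L\<close>, these are finite sums and the limit is taken termwise.\<close>

lemma gibbs_construction: "gibbs_random_field P"
proof -
  have "\<forall>n. \<exists>\<phi> M. (\<forall>S z. \<phi> S z \<noteq> 0 \<longrightarrow> finite S \<and> e n \<in> S \<and> S \<subseteq> e ` {n..}) \<and>
    (\<forall>S. local_on S (\<phi> S)) \<and> (\<forall>S z. \<bar>\<phi> S z\<bar> \<le> M S) \<and> M summable_on UNIV \<and>
    (\<forall>z D. incseq D \<longrightarrow> (\<forall>j. finite (D j)) \<longrightarrow> (\<Union>j. D j) = UNIV \<longrightarrow>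
      (\<lambda>j. log_step P e n (D j) z) \<longlonglongrightarrow> (\<Sum>\<^sub>\<infinity>S. \<phi> S z))"
    using block_expansion[OF e log_step_local[OF e] log_step_cauchy] by blast
  from choice[OF this] obtain \<phi> where "\<forall>n. \<exists>M. (\<forall>S z. \<phi> n S z \<noteq> 0 \<longrightarrow> finite S \<and> e n \<in> S \<and> S \<subseteq> e ` {n..}) \<and>
    (\<forall>S. local_on S (\<phi> n S)) \<and> (\<forall>S z. \<bar>\<phi> n S z\<bar> \<le> M S) \<and> M summable_on UNIV \<and>
    (\<forall>z D. incseq D \<longrightarrow> (\<forall>j. finite (D j)) \<longrightarrow> (\<Union>j. D j) = UNIV \<longrightarrow>
      (\<lambda>j. log_step P e n (D j) z) \<longlonglongrightarrow> (\<Sum>\<^sub>\<infinity>S. \<phi> n S z))" ..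
  from choice[OF this] obtain M where *: "\<forall>n. (\<forall>S z. \<phi> n S z \<noteq> 0 \<longrightarrow> finite S \<and> e n \<in> S \<and> S \<subseteq> e ` {n..}) \<and>
    (\<forall>S. local_on S (\<phi> n S)) \<and> (\<forall>S z. \<bar>\<phi> n S z\<bar> \<le> M n S) \<and> M n summable_on UNIV \<and>
    (\<forall>z D. incseq D \<longrightarrow> (\<forall>j. finite (D j)) \<longrightarrow> (\<Union>j. D j) = UNIV \<longrightarrow>
      (\<lambda>j. log_step P e n (D j) z) \<longlonglongrightarrow> (\<Sum>\<^sub>\<infinity>S. \<phi> n S z))" ..
  have supp: "finite S" "e n \<in> S" "S \<subseteq> e ` {n..}" if "\<phi> n S z \<noteq> 0" for n S z
    using conjunct1[OF spec[OF *, of n]] that by blast+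
  have loc: "local_on S (\<phi> n S)" for n S using spec[OF *, of n] by simp
  have bound: "\<bar>\<phi> n S z\<bar> \<le> M n S" for n S z using spec[OF *, of n] by simp
  have M_summable: "M n summable_on A" for n A
    using spec[OF *, of n] summable_on_subset_banach[of "M n" UNIV A] by simp
  define G where "G n z = (\<Sum>\<^sub>\<infinity>S. \<phi> n S z)" for n z
  have lim: "(\<lambda>j. log_step P e n (D j) z) \<longlonglongrightarrow> G n z"
    if "incseq D" "\<And>j. finite (D j)" "(\<Union>j. D j) = UNIV" for n z and D :: "nat \<Rightarrow> 'n site set"
    using spec[OF *, of n] that unfolding G_def by simp
  have \<phi>_summable: "(\<lambda>S. \<phi> n S z) summable_on A" for n z A
    by (rule abs_summable_summable, rule Infinite_Sum.abs_summable_on_comparison_test'[OF M_summable[of n]])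
      (simp add: bound)

  \<comment> \<open>The sign compensates the minus in the Gibbs weight. Restricting to
    \<open>e n \<in> S\<close> omits only zero terms and leaves finitely many for finite
    \<open>S\<close>.\<close>
  define \<Phi> where "\<Phi> S z = - (\<Sum>n | e n \<in> S. \<phi> n S z)" for S z
  have \<Phi>_loc: "local_on S (\<Phi> S)" for S
    unfolding \<Phi>_def[abs_def]
    by (intro local_onI arg_cong[where f = uminus] sum.cong refl local_onD[OF loc])
  \<comment> \<open>A set that meets the first \<open>N\<close> sites carries no contribution with
    index \<open>n \<ge> N\<close>. This trades the index set depending on \<open>S\<close> for a
    fixed one, so that sums over \<open>n\<close> and \<open>S\<close> can be interchanged.\<close>
  have \<Phi>_eq: "\<Phi> S z = - (\<Sum>n<N. \<phi> n S z)" if S: "finite S" "S \<inter> e ` {..<N} \<noteq> {}" for S z N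
  proof -
    have "finite {n. e n \<in> S}"
      using finite_vimageI[OF S(1) bij_is_inj[OF e]] by (simp add: vimage_def)
    moreover have "\<phi> n S z = 0" if n: "n \<ge> N" for n
    proof (rule ccontr)
      assume "\<phi> n S z \<noteq> 0"
      then have "S \<subseteq> e ` {n..}" by (rule supp)
      moreover obtain i where "i < N" "e i \<in> S" using S(2) by blast
      ultimately obtain i' where "i' \<ge> n" "e i' = e i" by force
      then show False using \<open>i < N\<close> n bij_is_inj[OF e] by (simp add: inj_eq)
    qed
    ultimately have "(\<Sum>n | e n \<in> S. \<phi> n S z) = (\<Sum>n<N. \<phi> n S z)"
      using supp(2)[of _ S z] by (intro sum.mono_neutral_cong) auto
    then show ?thesis by (simp add: \<Phi>_def)
  qed

  have ucp: "uniformly_convergent_potential \<Phi>"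
    unfolding uniformly_convergent_potential_def Let_def
  proof (intro allI ballI)
    fix t :: "'n site" and x :: "('n, 'x) config" assume "x \<in> configs {t}"
    obtain j where t: "t = e j" using bij_is_surj[OF e] by blast
    let ?u = "\<lambda>b J. \<Phi> ({t} \<union> J) (merge {t} J (x, restrict b J))"
    \<comment> \<open>The majorant for the Weierstrass test: a set containing \<open>e j\<close> is
      charged only by indices up to \<open>j\<close>.\<close>
    let ?M = "\<lambda>J. \<Sum>n<Suc j. M n (insert t J)"
    have le: "norm (?u b J) \<le> ?M J" if "J \<in> Fpow (- {t})" for b J
    proof -
      have "?u b J = - (\<Sum>n<Suc j. \<phi> n ({t} \<union> J) (merge {t} J (x, restrict b J)))"
        using that t by (intro \<Phi>_eq) (auto simp: Fpow_def)
      then have "norm (?u b J) \<le> (\<Sum>n<Suc j. \<bar>\<phi> n ({t} \<union> J) (merge {t} J (x, restrict b J))\<bar>)"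
        by (simp only: real_norm_def abs_minus_cancel sum_abs)
      also have "\<dots> \<le> ?M J" using bound by (intro sum_mono) simp
      finally show ?thesis .
    qed
    have M: "?M summable_on Fpow (- {t})"
    proof -
      have "inj_on (insert t) (Fpow (- {t}))" by (auto simp: inj_on_def Fpow_def)
      then have "(M n \<circ> insert t) summable_on Fpow (- {t})" for n
        using M_summable[of n] by (simp flip: summable_on_reindex)
      then have "((\<lambda>J. M n (insert t J)) has_sum infsum (M n \<circ> insert t) (Fpow (- {t}))) (Fpow (- {t}))" for n
        by (simp add: comp_def)
      then have "(?M has_sum (\<Sum>n<Suc j. infsum (M n \<circ> insert t) (Fpow (- {t})))) (Fpow (- {t}))"
        by (intro has_sum_finite_sum finite_lessThan)
      then show ?thesis unfolding summable_on_def by blast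
    qed
    show "(\<forall>b\<in>configs (- {t}). ?u b summable_on Fpow (- {t})) \<and>
        uniform_limit (configs (- {t})) (\<lambda>\<J> b. \<Sum>J\<in>\<J>. ?u b J)
          (\<lambda>b. \<Sum>\<^sub>\<infinity>J\<in>Fpow (- {t}). ?u b J) (finite_subsets_at_top (Fpow (- {t})))"
    proof
      show "\<forall>b\<in>configs (- {t}). ?u b summable_on Fpow (- {t})"
        by (intro ballI) (rule abs_summable_summable[OF Infinite_Sum.abs_summable_on_comparison_test'[OF M le]])
      show "uniform_limit (configs (- {t})) (\<lambda>\<J> b. \<Sum>J\<in>\<J>. ?u b J)
          (\<lambda>b. \<Sum>\<^sub>\<infinity>J\<in>Fpow (- {t}). ?u b J) (finite_subsets_at_top (Fpow (- {t})))"
        using le M by (intro Weierstrass_m_test_general)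
    qed
  qed

  \<comment> \<open>\<open>G n\<close> sums over all blocks, the energy only over those that meet
    \<open>L\<close>. The difference, from blocks disjoint from \<open>L\<close>, depends on the
    exterior \<open>b\<close> alone and cancels in the specification.\<close>
  have energy: "gibbs_energy \<Phi> L b x
      = (\<Sum>n<N. \<Sum>\<^sub>\<infinity>S\<in>{S. S \<inter> L = {}}. \<phi> n S b) - (\<Sum>n<N. G n (override_on b x L))"
    if L: "finite L" "L \<subseteq> e ` {..<N}" for L N b x
  proof -
    let ?z = "override_on b x L"
    \<comment> \<open>The contribution of the blocks whose trace on \<open>L\<close> is
      \<open>J\<close>, matching the outer sum of the energy.\<close>
    define H where "H n J = (\<Sum>\<^sub>\<infinity>S\<in>{S. S \<inter> L = J}. \<phi> n S ?z)" for n J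
    have H_empty: "H n {} = (\<Sum>\<^sub>\<infinity>S\<in>{S. S \<inter> L = {}}. \<phi> n S b)" for n
      unfolding H_def
      by (intro infsum_cong local_onD[OF loc]) (auto simp: override_on_def)
    have G_eq: "G n ?z = (\<Sum>J\<in>Pow L. H n J)" for n
    proof -
      have "(\<Sum>J\<in>Pow L. H n J) = (\<Sum>\<^sub>\<infinity>S\<in>(\<Union>J\<in>Pow L. {S. S \<inter> L = J}). \<phi> n S ?z)"
        unfolding H_def
        by (rule sum_infsum[OF finite_Pow_iff[THEN iffD2, OF L(1)] \<phi>_summable]) blast
      also have "(\<Union>J\<in>Pow L. {S. S \<inter> L = J}) = UNIV" by (intro set_eqI iffI UNIV_I UN_I[of "_ \<inter> L"]) simp_all
      finally show ?thesis by (simp add: G_def)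
    qed
    have part: "(\<Sum>\<^sub>\<infinity>K\<in>Fpow (- L). \<Phi> (J \<union> K) (merge J K (restrict x J, restrict b K))) = - (\<Sum>n<N. H n J)"
      if J: "J \<in> Pow L - {{}}" for J
    proof -
      have fin_J: "finite J" using J L(1) by (auto intro: finite_subset)
      have img: "(\<union>) J ` Fpow (- L) = {S. finite S \<and> S \<inter> L = J}"
      proof safe
        fix S assume "finite S" "J = S \<inter> L"
        then show "S \<in> (\<union>) (S \<inter> L) ` Fpow (- L)"
          by (intro image_eqI[of _ _ "S - L"]) (auto simp: Fpow_def)
      qed (use J fin_J in \<open>auto simp: Fpow_def\<close>)
      have inj: "inj_on ((\<union>) J) (Fpow (- L))"
        using J by (auto simp: inj_on_def Fpow_def)
      have "((\<lambda>S. \<phi> n S ?z) has_sum H n J) {S. S \<inter> L = J}" for n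
        unfolding H_def by (intro has_sum_infsum \<phi>_summable)
      \<comment> \<open>Infinite sets contribute 0, so the sum may be restricted to finite ones,
        which are the sets \<open>J \<union> K\<close> of the energy.\<close>
      then have "((\<lambda>S. \<phi> n S ?z) has_sum H n J) {S. finite S \<and> S \<inter> L = J}" for n
        by (rule has_sum_cong_neutral[THEN iffD1, rotated -1]) (use supp(1) in auto)
      then have "((\<lambda>K. \<phi> n (J \<union> K) ?z) has_sum H n J) (Fpow (- L))" for n
        unfolding img[symmetric] has_sum_reindex[OF inj] by (simp add: comp_def)
      then have "((\<lambda>K. \<Sum>n<N. \<phi> n (J \<union> K) ?z) has_sum (\<Sum>n<N. H n J)) (Fpow (- L))"
        by (intro has_sum_finite_sum finite_lessThan)
      then have "((\<lambda>K. - (\<Sum>n<N. \<phi> n (J \<union> K) ?z)) has_sum - (\<Sum>n<N. H n J)) (Fpow (- L))"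
        by (simp add: has_sum_uminus)
      moreover have "\<Phi> (J \<union> K) (merge J K (restrict x J, restrict b K)) = - (\<Sum>n<N. \<phi> n (J \<union> K) ?z)"
        if K: "K \<in> Fpow (- L)" for K
      proof -
        have "\<Phi> (J \<union> K) (merge J K (restrict x J, restrict b K)) = \<Phi> (J \<union> K) ?z"
          using J K by (intro local_onD[OF \<Phi>_loc]) (auto simp: merge_def override_on_def Fpow_def)
        also have "\<dots> = - (\<Sum>n<N. \<phi> n (J \<union> K) ?z)"
        proof (rule \<Phi>_eq)
          show "finite (J \<union> K)" using K fin_J by (simp add: Fpow_def)
          show "(J \<union> K) \<inter> e ` {..<N} \<noteq> {}" using J L(2) by blast
        qed
        finally show ?thesis .
      qed
      ultimately show ?thesis by (simp add: infsumI cong: infsum_cong)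
    qed
    have "gibbs_energy \<Phi> L b x = (\<Sum>J\<in>Pow L - {{}}. - (\<Sum>n<N. H n J))"
      unfolding gibbs_energy_def by (intro sum.cong refl part)
    also have "\<dots> = - (\<Sum>n<N. \<Sum>J\<in>Pow L - {{}}. H n J)"
      by (subst sum.swap) (simp add: sum_negf)
    also have "\<dots> = - (\<Sum>n<N. G n ?z - H n {})"
      using L(1) by (simp add: G_eq sum_diff1)
    finally show ?thesis by (simp add: sum_subtractf H_empty)
  qed

  have spec: "gibbs_specification \<Phi> L b x = exp (\<Sum>n<N. G n (override_on b x L))
      / (\<Sum>y\<in>configs L. exp (\<Sum>n<N. G n (override_on b y L)))"
    if L: "finite L" "L \<subseteq> e ` {..<N}" for L N b x
  proof -
    define K where "K = exp (- (\<Sum>n<N. \<Sum>\<^sub>\<infinity>S\<in>{S. S \<inter> L = {}}. \<phi> n S b))"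
    have "exp (- gibbs_energy \<Phi> L b y) = exp (\<Sum>n<N. G n (override_on b y L)) * K" for y
      by (simp add: energy[OF L] K_def flip: exp_add)
    moreover have "K \<noteq> 0" by (simp add: K_def)
    ultimately show ?thesis
      by (simp add: gibbs_specification_def flip: sum_distrib_right)
  qed

  have "cond_distribution_version P (gibbs_specification \<Phi>)"
    unfolding cond_distribution_version_def
  proof (intro allI impI conjI ballI)
    fix L :: "'n site set" and b x :: "('n, 'x) config" assume "finite L"
    then show "gibbs_specification \<Phi> L b x \<ge> 0" "(\<Sum>x\<in>configs L. gibbs_specification \<Phi> L b x) = 1"
      by (simp_all add: gibbs_specification_sum less_imp_le gibbs_specification_pos)
  next
    fix L and D :: "nat \<Rightarrow> 'n site set"
    assume L: "finite L" and D: "incseq D" "\<forall>n. finite (D n)" "(\<Union>n. D n) = - L"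
    obtain k where "L \<subseteq> e ` {..k}" using finite_subset_initial_segment[OF e L] by blast
    then have N: "L \<subseteq> e ` {..<Suc k}" by (simp add: lessThan_Suc_atMost)
    have W: "incseq (\<lambda>j. L \<union> D j)" "\<And>j. finite (L \<union> D j)" "(\<Union>j. L \<union> D j) = UNIV"
      using D L by (auto simp: incseq_def)
    have disj: "L \<inter> D j = {}" for j using D(3) by auto
    show "AE b in marginal P (- L). \<forall>x\<in>configs L.
        (\<lambda>n. marginal_prob P (L \<union> D n) (merge L (D n) (x, restrict b (D n)))
          / marginal_prob P (D n) (restrict b (D n))) \<longlonglongrightarrow> gibbs_specification \<Phi> L b x"
    \<comment> \<open>For this specification the limit exists at every exterior configuration, so
      the exceptional set is empty.\<close>
    proof (intro AE_I2 ballI)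
      fix b x :: "('n, 'x) config" assume x: "x \<in> configs L"
      have "(\<Sum>y\<in>configs L. exp (\<Sum>n<Suc k. G n (override_on b y L))) > 0"
        using finite_configs[OF L] by (intro sum_pos) (auto simp: configs_def PiE_eq_empty_iff)
      then have "(\<lambda>j. exp (\<Sum>n<Suc k. log_step P e n (L \<union> D j) (override_on b x L))
          / (\<Sum>y\<in>configs L. exp (\<Sum>n<Suc k. log_step P e n (L \<union> D j) (override_on b y L))))
        \<longlonglongrightarrow> exp (\<Sum>n<Suc k. G n (override_on b x L))
          / (\<Sum>y\<in>configs L. exp (\<Sum>n<Suc k. G n (override_on b y L)))"
        by (intro tendsto_divide tendsto_exp tendsto_sum lim W) auto
      then show "(\<lambda>n. marginal_prob P (L \<union> D n) (merge L (D n) (x, restrict b (D n)))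
          / marginal_prob P (D n) (restrict b (D n))) \<longlonglongrightarrow> gibbs_specification \<Phi> L b x"
        using D(2) by (simp only: cond_prob_log_steps[OF L _ disj N x] spec[OF L N])
    qed
  qed
  with ucp field show ?thesis unfolding gibbs_random_field_def by blast
qed

end

theorem mainTheorem2:
  fixes P :: "(int ^ 'n::finite \<Rightarrow> 'x::finite) measure"
  assumes "random_field P"
  shows "(gibbs_random_field P \<longleftrightarrow>
            strictly_positive P \<and> uniformly_nonnull P \<and> (cond_C P \<or> cond_D P \<or> cond_E P)) \<and>
         (strictly_positive P \<and> uniformly_nonnull P \<longrightarrow>
            (cond_C P \<longleftrightarrow> cond_D P) \<and> (cond_D P \<longleftrightarrow> cond_E P))"
proof -
  have "bij (from_nat_into (UNIV :: 'n site set))"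
    by (rule bij_betw_from_nat_into) (auto simp: infinite_sites)
  then have "gibbs_random_field P" if "strictly_positive P" "uniformly_nonnull P" "cond_C P"
    using that assms by (intro gibbs_construction) (auto simp: strictly_positive_iff cond_C_iff)
  moreover have "(cond_C P \<longleftrightarrow> cond_D P) \<and> (cond_D P \<longleftrightarrow> cond_E P)" if "strictly_positive P"
    using cond_C_D_E_equiv[OF assms that] by blast
  ultimately show ?thesis
    using gibbs_imp_positive[OF assms] gibbs_imp_nonnull[OF assms] gibbs_imp_cond_C[OF assms] by blast
qed

end
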